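(* Let $\mathscr{C}_\nu(z)$ denote $J_\nu(z)$, $Y_\nu(z)$, $H_\nu^{(1)}(z)$, $H_\nu^{(2)}(z)$ or any linear combination of these functions in which the coefficients are independent of $\nu$ and $z$. Then for $n\in\mathbb{N}=\{0,1,2,\ldots\}$, $$\frac{\mathrm{d}^{2n}}{\mathrm{d}z^{2n}}\left(\frac{\mathscr{C}_\nu(z)}{z^\nu}\right)=\sum_{k=0}^n(-1)^{n+k}A_k^n(\nu)\frac{\mathscr{C}_{\nu+2k}(z)}{z^\nu},\qquad \nu\in\mathbb{C}\setminus(-[2n-1]),$$ $$\frac{\mathrm{d}^{2n+1}}{\mathrm{d}z^{2n+1}}\left(\frac{\mathscr{C}_\nu(z)}{z^\nu}\right)=\sum_{k=0}^n(-1)^{n+k+1}B_k^n(\nu)\frac{\mathscr{C}_{\nu+2k+1}(z)}{z^\nu},\qquad \nu\in\mathbb{C}\setminus(-[2n]),$$ $$\frac{\mathrm{d}^{2n}}{\mathrm{d}z^{2n}}(z^\nu\mathscr{C}_\nu(z))=\sum_{k=0}^n(-1)^{n+k}A_k^n(-\nu)z^\nu\mathscr{C}_{\nu-2k}(z),\qquad \nu\in\mathbb{C}\setminus[2n-1],$$ $$\frac{\mathrm{d}^{2n+1}}{\mathrm{d}z^{2n+1}}(z^\nu\mathscr{C}_\nu(z))=\sum_{k=0}^n(-1)^{n+k}B_k^n(-\nu)z^\nu\mathscr{C}_{\nu-2k-1}(z),\qquad \nu\in\mathbb{C}\setminus[2n].$$ Let $\mathscr{L}_\nu(z)$ denote $I_\nu(z)$,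 $e^{\nu\pi i}K_\nu(z)$ or any linear combination of these functions in which the coefficients are independent of $\nu$ and $z$. Then for $n\in\mathbb{N}$, $$\frac{\mathrm{d}^{2n}}{\mathrm{d}z^{2n}}\left(\frac{\mathscr{L}_\nu(z)}{z^\nu}\right)=\sum_{k=0}^nA_k^n(\nu)\frac{\mathscr{L}_{\nu+2k}(z)}{z^\nu},\qquad \nu\in\mathbb{C}\setminus(-[2n-1]),$$ $$\frac{\mathrm{d}^{2n+1}}{\mathrm{d}z^{2n+1}}\left(\frac{\mathscr{L}_\nu(z)}{z^\nu}\right)=\sum_{k=0}^nB_k^n(\nu)\frac{\mathscr{L}_{\nu+2k+1}(z)}{z^\nu},\qquad \nu\in\mathbb{C}\setminus(-[2n]),$$ $$\frac{\mathrm{d}^{2n}}{\mathrm{d}z^{2n}}(z^\nu\mathscr{L}_\nu(z))=\sum_{k=0}^nA_k^n(-\nu)z^\nu\mathscr{L}_{\nu-2k}(z),\qquad \nu\in\mathbb{C}\setminus[2n-1],$$ $$\frac{\mathrm{d}^{2n+1}}{\mathrm{d}z^{2n+1}}(z^\nu\mathscr{L}_\nu(z))=\sum_{k=0}^nB_k^n(-\nu)z^\nu\mathscr{L}_{\nu-2k-1}(z),\qquad \nu\in\mathbb{C}\setminus[2n].$$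
   Context: $J_\nu,Y_\nu$ are the Bessel functions of the first and second kind, $H_\nu^{(1)},H_\nu^{(2)}$ the Hankel functions, and $I_\nu,K_\nu$ the modified Bessel functions of the first and second kind, with their standard definitions (as in the NIST Handbook of Mathematical Functions); $z\neq0$ is complex and all multivalued functions (including $z^{\pm\nu}$) are taken on a common fixed branch. For $n\in\mathbb{N}$, $0\le k\le n$ and $\nu\in\mathbb{C}$, define $$A_k^n(\nu)=\frac{(2n)!\,(\nu+2k)\prod_{j=0}^{k-1}(2\nu+2j+1)}{2^{2n-k}(2k)!\,(n-k)!\prod_{j=0}^n(\nu+k+j)},\qquad B_k^n(\nu)=\frac{(2n+1)!\,(\nu+2k+1)\prod_{j=0}^{k-1}(2\nu+2j+1)}{2^{2n-k}(2k+1)!\,(n-k)!\prod_{j=0}^n(\nu+k+j+1)},$$ with the empty product equal to $1$. The numerator factor $\nu+2k$ (resp. $\nu+2k+1$) is cancelled against the equal factor $j=k$ of the denominator product; thus $A_k^n(\nu)$ is defined for all $\nu$ other than the integers $-k,-(k+1),\ldots,-(k+n)$ different from $-2k$, and $B_k^n(\nu)$ for all $\nu$ other than the integers $-(k+1),\ldots,-(k+n+1)$ different from $-(2k+1)$. For $N\ge1$, $[N]=\{1,2,\ldots,N\}$ and $-[N]=\{-1,-2,\ldots,-N\}$; $[0],[-1],-[0],-[-1]$ are the empty set. *)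

theory Defs
  imports "HOL-Analysis.Analysis"
begin

text \<open>
  All multivalued functions are taken on one common branch, given by an open set \<open>S\<close> and a branch
  \<open>L\<close> of the logarithm on \<open>S\<close>.  The equation forces \<open>0 \<notin> S\<close>; \<open>S\<close> need not be simply connected, nor
  \<open>L\<close> the principal branch.
\<close>
definition log_branch :: "(complex \<Rightarrow> complex) \<Rightarrow> complex set \<Rightarrow> bool" where
  "log_branch L S \<longleftrightarrow> open S \<and> L holomorphic_on S \<and> (\<forall>z\<in>S. exp (L z) = z)"

definition branch_pow :: "(complex \<Rightarrow> complex) \<Rightarrow> complex \<Rightarrow> complex \<Rightarrow> complex" where
  "branch_pow L \<nu> z = exp (\<nu> * L z)"

text \<open>
  DLMF 10.2.2 and 10.25.2.  The prefactor is \<open>(z/2)\<^sup>\<nu> = z\<^sup>\<nu> / 2\<^sup>\<nu>\<close> on the given branch, with the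
  principal value of \<open>2\<^sup>\<nu>\<close>.  The entire function \<open>rGamma\<close> is \<open>1 / \<Gamma>\<close>, with value 0 at the poles of \<open>\<Gamma>\<close>.
\<close>
definition bessel_J :: "(complex \<Rightarrow> complex) \<Rightarrow> complex \<Rightarrow> complex \<Rightarrow> complex" where
  "bessel_J L \<nu> z = branch_pow L \<nu> z / 2 powr \<nu> *
     (\<Sum>m. (-1) ^ m * (z\<^sup>2 / 4) ^ m * rGamma (\<nu> + of_nat m + 1) / fact m)"

definition bessel_I :: "(complex \<Rightarrow> complex) \<Rightarrow> complex \<Rightarrow> complex \<Rightarrow> complex" where
  "bessel_I L \<nu> z = branch_pow L \<nu> z / 2 powr \<nu> *
     (\<Sum>m. (z\<^sup>2 / 4) ^ m * rGamma (\<nu> + of_nat m + 1) / fact m)"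

text \<open>DLMF 10.2.3 and 10.27.4; at integer order the quotient is replaced by its limiting value.\<close>
definition bessel_Y :: "(complex \<Rightarrow> complex) \<Rightarrow> complex \<Rightarrow> complex \<Rightarrow> complex" where
  "bessel_Y L \<nu> z =
     (let q = (\<lambda>\<mu>. (bessel_J L \<mu> z * cos (\<mu> * of_real pi) - bessel_J L (-\<mu>) z) / sin (\<mu> * of_real pi))
      in if \<nu> \<in> \<int> then Lim (at \<nu>) q else q \<nu>)"

definition bessel_K :: "(complex \<Rightarrow> complex) \<Rightarrow> complex \<Rightarrow> complex \<Rightarrow> complex" where
  "bessel_K L \<nu> z =
     (let q = (\<lambda>\<mu>. of_real pi / 2 * (bessel_I L (-\<mu>) z - bessel_I L \<mu> z) / sin (\<mu> * of_real pi))
      in if \<nu> \<in> \<int> then Lim (at \<nu>) q else q \<nu>)"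

definition hankel_H1 :: "(complex \<Rightarrow> complex) \<Rightarrow> complex \<Rightarrow> complex \<Rightarrow> complex" where
  "hankel_H1 L \<nu> z = bessel_J L \<nu> z + \<i> * bessel_Y L \<nu> z"

definition hankel_H2 :: "(complex \<Rightarrow> complex) \<Rightarrow> complex \<Rightarrow> complex \<Rightarrow> complex" where
  "hankel_H2 L \<nu> z = bessel_J L \<nu> z - \<i> * bessel_Y L \<nu> z"

definition cylinder_comb ::
  "complex \<Rightarrow> complex \<Rightarrow> complex \<Rightarrow> complex \<Rightarrow> (complex \<Rightarrow> complex) \<Rightarrow> complex \<Rightarrow> complex \<Rightarrow> complex" where
  "cylinder_comb a b c d L \<nu> z =
     a * bessel_J L \<nu> z + b * bessel_Y L \<nu> z + c * hankel_H1 L \<nu> z + d * hankel_H2 L \<nu> z"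

definition modified_comb ::
  "complex \<Rightarrow> complex \<Rightarrow> (complex \<Rightarrow> complex) \<Rightarrow> complex \<Rightarrow> complex \<Rightarrow> complex" where
  "modified_comb p q L \<nu> z =
     p * bessel_I L \<nu> z + q * (exp (\<nu> * of_real pi * \<i>) * bessel_K L \<nu> z)"

text \<open>
  The numerator factor \<open>\<nu> + 2k\<close> (resp. \<open>\<nu> + 2k + 1\<close>) is cancelled against the factor \<open>j = k\<close> of the
  denominator product, which is therefore omitted from the index set.
\<close>
definition coeff_A :: "nat \<Rightarrow> nat \<Rightarrow> complex \<Rightarrow> complex" where
  "coeff_A n k \<nu> =
     (fact (2*n) * (\<Prod>j<k. 2*\<nu> + 2 * of_nat j + 1)) /
     (2 ^ (2*n - k) * fact (2*k) * fact (n - k) * (\<Prod>j\<in>{0..n} - {k}. \<nu> + of_nat k + of_nat j))"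

definition coeff_B :: "nat \<Rightarrow> nat \<Rightarrow> complex \<Rightarrow> complex" where
  "coeff_B n k \<nu> =
     (fact (2*n + 1) * (\<Prod>j<k. 2*\<nu> + 2 * of_nat j + 1)) /
     (2 ^ (2*n - k) * fact (2*k + 1) * fact (n - k) * (\<Prod>j\<in>{0..n} - {k}. \<nu> + of_nat k + of_nat j + 1))"

lemma coeff_A_uncancelled:
  assumes "k \<le> n" "\<nu> + 2 * of_nat k \<noteq> 0"
  shows "coeff_A n k \<nu> =
     (fact (2*n) * (\<nu> + 2 * of_nat k) * (\<Prod>j<k. 2*\<nu> + 2 * of_nat j + 1)) /
     (2 ^ (2*n - k) * fact (2*k) * fact (n - k) * (\<Prod>j=0..n. \<nu> + of_nat k + of_nat j))"
proof -
  have "(\<Prod>j=0..n. \<nu> + of_nat k + of_nat j) =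
      (\<nu> + 2 * of_nat k) * (\<Prod>j\<in>{0..n} - {k}. \<nu> + of_nat k + of_nat j)"
    using assms(1) by (subst prod.remove[of _ k]) (simp_all add: algebra_simps)
  then show ?thesis
    using assms(2) by (simp add: coeff_A_def)
qed

lemma coeff_B_uncancelled:
  assumes "k \<le> n" "\<nu> + 2 * of_nat k + 1 \<noteq> 0"
  shows "coeff_B n k \<nu> =
     (fact (2*n + 1) * (\<nu> + 2 * of_nat k + 1) * (\<Prod>j<k. 2*\<nu> + 2 * of_nat j + 1)) /
     (2 ^ (2*n - k) * fact (2*k + 1) * fact (n - k) * (\<Prod>j=0..n. \<nu> + of_nat k + of_nat j + 1))"
proof -
  have "(\<Prod>j=0..n. \<nu> + of_nat k + of_nat j + 1) =
      (\<nu> + 2 * of_nat k + 1) * (\<Prod>j\<in>{0..n} - {k}. \<nu> + of_nat k + of_nat j + 1)"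
    using assms(1) by (subst prod.remove[of _ k]) (simp_all add: algebra_simps)
  then show ?thesis
    using assms(2) by (simp add: coeff_B_def del: fact_Suc)
qed

text \<open>
  \<open>[N] = {1, \<dots>, N}\<close> inside the complex numbers.  The set \<open>[2n - 1]\<close> is written with truncated
  subtraction: for \<open>n = 0\<close> it becomes \<open>[0]\<close>, which is empty, as is \<open>[-1]\<close> by convention.
\<close>
definition int_seg :: "nat \<Rightarrow> complex set" where
  "int_seg N = of_nat ` {1..N}"

definition neg_int_seg :: "nat \<Rightarrow> complex set" where
  "neg_int_seg N = uminus ` int_seg N"

text \<open>
  Since \<open>deriv\<close> is total, analyticity at the point is required in addition; it makes the
  derivatives of every order exist there.
\<close>
definition has_nth_complex_derivative ::
  "(complex \<Rightarrow> complex) \<Rightarrow> nat \<Rightarrow> complex \<Rightarrow> complex \<Rightarrow> bool" where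
  "has_nth_complex_derivative f m D z \<longleftrightarrow> f analytic_on {z} \<and> (deriv ^^ m) f z = D"

end

theory Submission
  imports Defs "HOL-Complex_Analysis.Conformal_Mappings"
begin

text \<open>
  All functions concerned satisfy, for one sign \<open>s\<close>, the relations
  \<open>G\<^sub>\<mu>' = (\<mu>/z) G\<^sub>\<mu> + s G\<^bsub>\<mu>+1\<^esub>\<close> and \<open>G\<^bsub>\<mu>-1\<^esub> - s G\<^bsub>\<mu>+1\<^esub> = (2\<mu>/z) G\<^sub>\<mu>\<close>, with \<open>s = -1\<close> for cylinder
  functions and \<open>s = 1\<close> for modified ones.  The derivative formulas follow from these relations alone,
  by induction on the order: eliminating the factor \<open>1/z\<close> divides only by \<open>\<nu> + i\<close> with
  \<open>1 \<le> i < m\<close> for the \<open>m\<close>-th derivative, so the exceptional orders are exactly the excluded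
  integers and no continuation in \<open>\<nu>\<close> is needed.  For \<open>Y\<close> and \<open>K\<close> at integer order the
  relations pass to the limit because the convergence is locally uniform in \<open>z\<close>.
\<close>

subsection \<open>Recurrences for the coefficients\<close>

text \<open>The obstacle is the term m/z times the function itself, left when z^(-\<nu>) G of order
  \<nu>+m is differentiated: the target formulas contain no such factor. The three-term relation
  spreads it over the neighbours m-1 and m+1. Up to signs, differentiation then sends index m to m-1
  with weight r = m/(2(\<nu>+m)) and to m+1 with weight 1-r. The coefficients A and B are the
  solution of this Pascal-type recurrence, and checking it comes down to partial fractions. At m = 0
  no factor 1/z arises, which is why \<nu> = 0 stays admissible and why the factor \<nu> of A with k
  = 0 has to be cancelled. At integer order Y and K are limits of 0/0 in the order, so
  differentiating them in z needs uniformity in z. It is obtained by complex analysis in the order: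
  on a circle around the integer the sine is bounded away from zero and the numerator is bounded
  uniformly for z in a compact set, and the maximum principle carries this inside.\<close>

lemma prod_shift_pochhammer: "(\<Prod>j=0..n. a + of_nat j) = pochhammer a (Suc n)" for a :: complex
  by (simp only: pochhammer_prod atLeastLessThanSuc_atLeastAtMost)

lemma coeff_A_pochhammer:
  assumes "k \<le> n" "\<nu> + 2 * of_nat k \<noteq> 0"
  shows "coeff_A n k \<nu> = fact (2*n) * (\<nu> + 2 * of_nat k) * (\<Prod>j<k. 2*\<nu> + 2 * of_nat j + 1) /
     (2 ^ (2*n - k) * fact (2*k) * fact (n - k) * pochhammer (\<nu> + of_nat k) (Suc n))"
  using coeff_A_uncancelled[OF assms] by (simp only: prod_shift_pochhammer)

lemma coeff_B_pochhammer:
  assumes "k \<le> n" "\<nu> + 2 * of_nat k + 1 \<noteq> 0"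
  shows "coeff_B n k \<nu> = fact (2*n + 1) * (\<nu> + 2 * of_nat k + 1) * (\<Prod>j<k. 2*\<nu> + 2 * of_nat j + 1) /
     (2 ^ (2*n - k) * fact (2*k + 1) * fact (n - k) * pochhammer (\<nu> + of_nat k + 1) (Suc n))"
proof -
  have "(\<Prod>j=0..n. \<nu> + of_nat k + of_nat j + 1) = pochhammer (\<nu> + of_nat k + 1) (Suc n)"
    unfolding prod_shift_pochhammer[symmetric] by (simp add: algebra_simps)
  with coeff_B_uncancelled[OF assms] show ?thesis by (simp only:)
qed

text \<open>For k = 0 the cancelled factor is \<nu> itself, so this form remains valid at \<nu> = 0,
  where \<open>coeff_A_pochhammer\<close> does not apply.\<close>

lemma coeff_A_0: "coeff_A n 0 \<nu> = fact (2*n) / (2 ^ (2*n) * fact n * pochhammer (\<nu> + 1) n)"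
proof -
  have "(\<Prod>j\<in>{0..n} - {0}. \<nu> + of_nat j) = pochhammer (\<nu> + 1) n"
    unfolding pochhammer_prod
    by (rule prod.reindex_bij_witness[of _ Suc "\<lambda>j. j - 1"]) auto
  then show ?thesis by (simp add: coeff_A_def)
qed

lemma prod_remove_last_pochhammer:
  "(\<Prod>j\<in>{0..n} - {n}. a + of_nat j) = pochhammer a n" for a :: complex
proof -
  have "{0..n} - {n} = {0..<n}" by auto
  then show ?thesis by (simp add: pochhammer_prod)
qed

text \<open>For k = n the omitted factor is the last one, \<nu> + 2n. The recurrences are used at
  values of \<nu> where it may vanish, hence a form that never mentions it;
  \<open>coeff_B_diag\<close> serves the same purpose for \<nu> + 2n + 1.\<close>

lemma coeff_A_diag: "coeff_A n n \<nu> = (\<Prod>j<n. 2*\<nu> + 2 * of_nat j + 1) / (2 ^ n * pochhammer (\<nu> + of_nat n) n)"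
proof -
  have "2*n - n = n" by simp
  then show ?thesis by (simp add: coeff_A_def prod_remove_last_pochhammer)
qed

lemma coeff_B_diag: "coeff_B n n \<nu> = (\<Prod>j<n. 2*\<nu> + 2 * of_nat j + 1) / (2 ^ n * pochhammer (\<nu> + of_nat n + 1) n)"
proof -
  have "(\<Prod>j\<in>{0..n} - {n}. \<nu> + of_nat n + of_nat j + 1) = pochhammer (\<nu> + of_nat n + 1) n"
    unfolding prod_remove_last_pochhammer[symmetric] by (simp add: algebra_simps)
  moreover have "2*n - n = n" by simp
  ultimately show ?thesis by (simp add: coeff_B_def del: fact_Suc)
qed

lemma not_neg_int_seg_iff: "\<nu> \<notin> neg_int_seg N \<longleftrightarrow> (\<forall>i. 1 \<le> i \<and> i \<le> N \<longrightarrow> \<nu> + of_nat i \<noteq> 0)"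
  unfolding neg_int_seg_def int_seg_def image_image by (force simp: eq_neg_iff_add_eq_0)

lemma add_of_nat_nonzero:
  "\<nu> \<notin> neg_int_seg N \<Longrightarrow> 1 \<le> i \<Longrightarrow> i \<le> N \<Longrightarrow> \<nu> + of_nat i \<noteq> 0"
  by (simp add: not_neg_int_seg_iff)

lemma not_int_seg_iff: "\<nu> \<notin> int_seg N \<longleftrightarrow> - \<nu> \<notin> neg_int_seg N"
  unfolding neg_int_seg_def by (metis add.inverse_inverse image_iff)

text \<open>The second factor is \<open>(\<nu> + k) / (\<nu> + 2k)\<close>, written so that it equals 1 for \<open>k = 0\<close> even if
  \<open>\<nu> = 0\<close>.\<close>
lemma coeff_A_up:
  assumes "\<nu> \<notin> neg_int_seg (2*n)" "k \<le> n"
  shows "coeff_A n k \<nu> * (1 - of_nat k / (\<nu> + 2 * of_nat k)) =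
    fact (2*n) * (\<Prod>j<k. 2*\<nu> + 2 * of_nat j + 1) /
     (2 ^ (2*n - k) * fact (2*k) * fact (n - k) * pochhammer (\<nu> + of_nat k + 1) n)"
proof (cases "k = 0")
  case True
  then show ?thesis by (simp add: coeff_A_0)
next
  case False
  have nz: "\<nu> + 2 * of_nat k \<noteq> 0" "\<nu> + of_nat k \<noteq> 0"
    using assms False unfolding not_neg_int_seg_iff by (auto dest: spec[of _ "2*k"])
  have "coeff_A n k \<nu> * (1 - of_nat k / (\<nu> + 2 * of_nat k)) = coeff_A n k \<nu> * ((\<nu> + of_nat k) / (\<nu> + 2 * of_nat k))"
    using nz by (simp add: field_simps)
  also have "\<dots> = fact (2*n) * (\<Prod>j<k. 2*\<nu> + 2 * of_nat j + 1) /
     (2 ^ (2*n - k) * fact (2*k) * fact (n - k) * pochhammer (\<nu> + of_nat k + 1) n)"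
    using nz by (simp add: coeff_A_pochhammer[OF assms(2) nz(1)] pochhammer_rec)
  finally show ?thesis .
qed

text \<open>This is what remains of \<open>coeff_B_from_A\<close> once the factors common to its
  terms are removed; c and p*w become the two separate denominators.
  \<open>partial_fractions'\<close> plays this part for \<open>coeff_A_Suc_from_B\<close>.\<close>

lemma partial_fractions:
  fixes c p t w :: "'a :: field"
  assumes "c \<noteq> 0" "p \<noteq> 0" "w \<noteq> 0"
  shows "(p * w + c * t) / (p * c * w) = 1 / c + t / (p * w)"
  using assms by (simp add: add_divide_distrib)

lemma partial_fractions':
  fixes c u v w :: "'a :: field_char_0"
  assumes "u \<noteq> 0" "c \<noteq> 0" "v \<noteq> 0" "w \<noteq> 0"
  shows "2 * (c * v + u * w) / (2 * u * c * v * w) = 1 / (u * w) + 1 / (c * v)"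
  using assms by (simp add: add_divide_distrib del: distrib_left_numeral)

text \<open>Index 2k+1 is reached from 2k with weight 1 - k/(\<nu>+2k) and from 2k+2 with weight
  (k+1)/(\<nu>+2k+2); at the upper end k = n only the former source exists.\<close>

lemma coeff_B_from_A:
  assumes "\<nu> \<notin> neg_int_seg (2*n)" "k \<le> n"
  shows "coeff_B n k \<nu> = coeff_A n k \<nu> * (1 - of_nat k / (\<nu> + 2 * of_nat k)) +
    (if k < n then coeff_A n (Suc k) \<nu> * of_nat (Suc k) / (\<nu> + 2 * of_nat (Suc k)) else 0)"
proof (cases "k = n")
  case True
  moreover have "2*n - n = n" by simp
  ultimately show ?thesis unfolding coeff_A_up[OF assms] by (simp add: coeff_B_diag)
next
  case False
  with assms have kn: "k < n" by simp
  define Q where "Q = (\<Prod>j<k. 2*\<nu> + 2 * of_nat j + 1)"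
  define X where "X = pochhammer (\<nu> + of_nat k + 1) n"
  define d where "d = n - Suc k"
  have n: "n = k + d + 1" using kn by (simp add: d_def)
  have X: "pochhammer (\<nu> + of_nat k + 1) (Suc n) = X * (\<nu> + of_nat k + 1 + of_nat n)"
    by (simp add: X_def pochhammer_Suc)
  have "\<nu> + of_nat (2*k+1) \<noteq> 0" "\<nu> + of_nat (2*k+2) \<noteq> 0" "\<nu> + of_nat (k+1+n) \<noteq> 0"
    by (rule add_of_nat_nonzero[OF assms(1)]; use kn in simp)+
  then have nz: "\<nu> + 2 * of_nat k + 1 \<noteq> 0" "\<nu> + 2 * of_nat (Suc k) \<noteq> 0" "\<nu> + of_nat k + 1 + of_nat n \<noteq> 0"
    by (simp_all add: algebra_simps)
  have p: "(2::complex) ^ (2*n - k) = 2 * 2 ^ (2*n - Suc k)" using kn by (simp add: Suc_diff_Suc flip: power_Suc)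
  have f: "fact (n - k) = of_nat (n - k) * (fact d :: complex)" "n - Suc k = d"
    "fact (2*k+1) = (2 * of_nat k + 1) * (fact (2*k) :: complex)"
    "fact (2*n+1) = (2 * of_nat n + 1) * (fact (2*n) :: complex)"
    "fact (2*Suc k) = (2 * of_nat k + 2) * ((2 * of_nat k + 1) * (fact (2*k) :: complex))"
    by (simp_all add: n algebra_simps)
  have g: "of_nat (n - k) = (of_nat n - of_nat k :: complex)" using kn by (simp add: of_nat_diff)
  have "of_nat n - of_nat k \<noteq> (0::complex)" using kn by simp
  have "of_nat (2*k+1) \<noteq> (0::complex)" "of_nat (k+1) \<noteq> (0::complex)" by (simp_all only: of_nat_eq_0_iff)
  then have kz: "2 * of_nat k + 1 \<noteq> (0::complex)" "of_nat k + 1 \<noteq> (0::complex)" by (simp_all add: add_ac)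
  define a where "a = (of_nat k :: complex)"
  define b where "b = (of_nat n :: complex)"
  define P where "P = (2::complex) ^ (2*n - Suc k)"
  define f1 where "f1 = (fact (2*k)::complex)"
  define f2 where "f2 = (fact (2*n)::complex)"
  define f3 where "f3 = (fact d::complex)"
  have B: "coeff_B n k \<nu> = (2*b+1)*f2 * (\<nu> + 2*a + 1) * Q / (2 * P * ((2*a+1)*f1) * ((b-a)*f3) * (X * (\<nu> + a + 1 + b)))"
    unfolding coeff_B_pochhammer[OF assms(2) nz(1)] f p g X a_def b_def P_def f1_def f2_def f3_def Q_def ..
  have A: "coeff_A n (Suc k) \<nu> = f2 * (\<nu> + 2*(a+1)) * (Q * (2*\<nu> + 2*a + 1)) / (P * ((2*a+2)*((2*a+1)*f1)) * f3 * (X * (\<nu> + a + 1 + b)))"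
  proof -
    have "\<nu> + of_nat (Suc k) = \<nu> + of_nat k + 1" by simp
    then have "pochhammer (\<nu> + of_nat (Suc k)) (Suc n) = X * (\<nu> + a + 1 + b)"
      by (simp only: X a_def b_def)
    moreover have "\<nu> + 2 * of_nat (Suc k) = \<nu> + 2*(a+1)" by (simp add: a_def)
    ultimately show ?thesis using coeff_A_pochhammer[OF Suc_leI[OF kn] nz(2)]
      by (simp add: a_def P_def f1_def f2_def f3_def Q_def f(2,5)
        del: fact_Suc pochhammer_Suc of_nat_Suc distrib_left_numeral mult_Suc_right)
  qed
  \<comment> \<open>The only real algebra in the recurrence: splitting the numerator along the two
    factors of the denominator separates the two contributions. What follows is matching of
    factors.\<close>
  have "(2*b+1) * (\<nu> + 2*a + 1) = (2*a+1)*(\<nu> + a + 1 + b) + (b-a)*(2*\<nu>+2*a+1)" by (simp add: algebra_simps)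
  then have *: "(2*b+1) * (\<nu> + 2*a + 1) / ((2*a+1) * (b-a) * (\<nu> + a + 1 + b)) =
     1 / (b-a) + (2*\<nu>+2*a+1) / ((2*a+1) * (\<nu> + a + 1 + b))"
    using \<open>of_nat n - of_nat k \<noteq> 0\<close> kz(1) nz(3) unfolding a_def[symmetric] b_def[symmetric]
    by (metis partial_fractions)
  have "coeff_B n k \<nu> = f2 * Q / (2 * P * f1 * f3 * X) * ((2*b+1) * (\<nu> + 2*a + 1) / ((2*a+1) * (b-a) * (\<nu> + a + 1 + b)))"
    unfolding B by (simp add: mult_ac)
  also have "\<dots> = f2 * Q / (2*P * f1 * ((b-a)*f3) * X) + f2 * Q * (2*\<nu>+2*a+1) / (2 * P * ((2*a+1)*f1) * f3 * (X * (\<nu> + a + 1 + b)))"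
    unfolding * by (simp add: distrib_left mult_ac)
  also have "f2 * Q / (2*P * f1 * ((b-a)*f3) * X) = coeff_A n k \<nu> * (1 - of_nat k / (\<nu> + 2 * of_nat k))"
    unfolding coeff_A_up[OF assms] f p g a_def b_def P_def f1_def f2_def f3_def Q_def X_def ..
  also have "f2 * Q * (2*\<nu>+2*a+1) / (2 * P * ((2*a+1)*f1) * f3 * (X * (\<nu> + a + 1 + b)))
     = coeff_A n (Suc k) \<nu> * of_nat (Suc k) / (\<nu> + 2 * of_nat (Suc k))"
  proof -
    have k: "of_nat (Suc k) = a + 1" by (simp add: a_def)
    have nz2: "\<nu> + 2 * (a+1) \<noteq> 0" "a + 1 \<noteq> 0" using nz(2) kz by (simp_all add: a_def add.commute)
    have e: "2*a+2 = 2*(a+1)" by simp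
    have "f2 * Q * T / (2 * P * (r*f1) * f3 * Y) = f2 * W * (Q * T) / (P * (2*u*(r*f1)) * f3 * Y) * u / W"
      if "W \<noteq> 0" "u \<noteq> 0" for W u T r Y
      using that by (simp add: mult_ac)
    from this[OF nz2] show ?thesis unfolding A e k by (simp only: times_divide_eq_left)
  qed
  finally show ?thesis using kn by simp
qed

text \<open>The upward weight at the odd index 2x+1. With x = k its numerator is the factor j = k of
  the product in A and B, which explains that product: it collects the upward weights at odd
  indices.\<close>

lemma one_minus_ratio:
  fixes \<nu> x :: complex
  assumes "\<nu> + 2 * x + 1 \<noteq> 0"
  shows "1 - (2 * x + 1) / (2 * (\<nu> + 2 * x + 1)) = (2 * \<nu> + 2 * x + 1) / (2 * (\<nu> + 2 * x + 1))"
proof -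
  have y: "2 * (\<nu> + 2 * x + 1) \<noteq> 0" using assms by (simp only: mult_eq_0_iff) simp
  have "2 * \<nu> + 2 * x + 1 = 2 * (\<nu> + 2 * x + 1) - (2 * x + 1)" by simp
  then show ?thesis by (simp only: diff_divide_eq_iff[OF y] mult_1_left)
qed

text \<open>Index 2k is reached from 2k+1 and from 2k-1, with the weights belonging to odd indices;
  each of the two ends has a single source. At k = n+1 the value \<nu> + 2n + 2 may be zero, so the
  diagonal forms are used there.\<close>

lemma coeff_A_Suc_from_B:
  assumes "\<nu> \<notin> neg_int_seg (2*n+1)" "k \<le> Suc n"
  shows "coeff_A (Suc n) k \<nu> =
    (if k \<le> n then coeff_B n k \<nu> * (2 * of_nat k + 1) / (2 * (\<nu> + 2 * of_nat k + 1)) else 0) +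
    (case k of 0 \<Rightarrow> 0 | Suc l \<Rightarrow> coeff_B n l \<nu> * (1 - (2 * of_nat l + 1) / (2 * (\<nu> + 2 * of_nat l + 1))))"
proof -
  consider "k = 0" | "k = Suc n" | l where "k = Suc l" "l < n" using assms(2) by (cases k) (auto simp: le_less)
  then show ?thesis
  proof cases
    case 1
    have "\<nu> + 1 \<noteq> 0" using add_of_nat_nonzero[OF assms(1), of 1] by simp
    moreover have "fact (2 * Suc n) = 2 * (of_nat (Suc n) :: complex) * fact (2*n+1)"
      "fact (Suc n) = (of_nat (Suc n) :: complex) * fact n"
      by (simp_all add: algebra_simps)
    moreover have "of_nat (Suc n) \<noteq> (0::complex)" by (simp only: of_nat_eq_0_iff)
    ultimately show ?thesis using 1
      by (simp add: coeff_A_0 coeff_B_pochhammer add_divide_distrib distrib_left[of 2 \<nu> 1, symmetric]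
         del: pochhammer_Suc fact_Suc of_nat_Suc distrib_left_numeral)
  next
    case 2
    have "\<nu> + of_nat (2*n+1) \<noteq> 0" by (rule add_of_nat_nonzero[OF assms(1)]) simp_all
    then have nz: "\<nu> + 2 * of_nat n + 1 \<noteq> 0" by (simp add: add_ac)
    note e = one_minus_ratio[OF nz]
    have "\<nu> + of_nat (Suc n) = \<nu> + of_nat n + 1" by simp
    then have "pochhammer (\<nu> + of_nat (Suc n)) (Suc n) = pochhammer (\<nu> + of_nat n + 1) n * (\<nu> + of_nat n + 1 + of_nat n)"
      by (simp only: pochhammer_Suc)
    also have "\<nu> + of_nat n + 1 + of_nat n = \<nu> + 2 * of_nat n + 1" by simp
    finally have "coeff_A (Suc n) (Suc n) \<nu> = coeff_B n n \<nu> * ((2*\<nu> + 2 * of_nat n + 1) / (2 * (\<nu> + 2 * of_nat n + 1)))"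
      by (simp only: coeff_A_diag coeff_B_diag prod.lessThan_Suc power_Suc times_divide_times_eq mult_ac)
    then show ?thesis unfolding 2 nat.case e[symmetric] by simp
  next
    case (3 l)
    define Q where "Q = (\<Prod>j<l. 2*\<nu> + 2 * of_nat j + 1)"
    \<comment> \<open>These n factors are common to the three Pochhammer products, which start at
      \<nu>+l+1, \<nu>+l+2 and \<nu>+l+1 and have n+1, n+1 and n+2 factors.\<close>
    define X where "X = pochhammer (\<nu> + of_nat l + 2) n"
    define a b P f1 f2 f3 :: complex where "a = of_nat l" and "b = of_nat n"
      and "P = 2 ^ (2*n - Suc l)" and "f1 = fact (2*l+1)" and "f2 = fact (2*n+1)" and "f3 = fact (n - Suc l)"
    define d where "d = n - Suc l"
    have n: "n = l + d + 1" using 3 by (simp add: d_def)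
    have "\<nu> + of_nat (2*l+1) \<noteq> 0" "\<nu> + of_nat (2*l+2) \<noteq> 0" "\<nu> + of_nat (2*l+3) \<noteq> 0"
      "\<nu> + of_nat (l+1) \<noteq> 0" "\<nu> + of_nat (l+2+n) \<noteq> 0"
      by (rule add_of_nat_nonzero[OF assms(1)]; use 3 in simp)+
    then have nz: "\<nu> + 2*a + 1 \<noteq> 0" "\<nu> + 2 * a + 2 \<noteq> 0" "\<nu> + 2 * a + 3 \<noteq> 0" "\<nu> + a + 1 \<noteq> 0" "\<nu> + a + 2 + b \<noteq> 0"
      by (simp_all add: a_def b_def algebra_simps)
    have ba: "of_nat (n - l) = b - a" using 3 by (simp add: of_nat_diff a_def b_def)
    have ba0: "b - a \<noteq> 0" using 3 by (simp add: a_def b_def)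
    have "of_nat (l+1) \<noteq> (0::complex)" "of_nat (2*l+3) \<noteq> (0::complex)" by (simp_all only: of_nat_eq_0_iff)
    then have az: "a + 1 \<noteq> 0" "2*a + 3 \<noteq> 0" by (simp_all add: a_def add_ac)
    have B0: "coeff_B n l \<nu> = f2 * (\<nu> + 2*a + 1) * Q / (2 * P * f1 * ((b - a) * f3) * ((\<nu> + a + 1) * X))"
    proof -
      have "(2::complex) ^ (2*n - l) = 2 * P" using 3 by (simp add: P_def Suc_diff_Suc flip: power_Suc)
      moreover have "fact (n - l) = (b - a) * f3"
        unfolding ba[symmetric] f3_def by (simp add: n)
      moreover have "pochhammer (\<nu> + of_nat l + 1) (Suc n) = (\<nu> + a + 1) * X"
        by (simp add: pochhammer_rec X_def a_def add.assoc)
      ultimately show ?thesis using coeff_B_pochhammer[of l n \<nu>] nz 3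
        by (simp add: a_def f1_def f2_def Q_def del: fact_Suc pochhammer_Suc)
    qed
    have B1: "coeff_B n (Suc l) \<nu> = f2 * (\<nu> + 2*a + 3) * (Q * (2*\<nu> + 2*a + 1)) / (P * (2*(a+1) * (2*a+3) * f1) * f3 * (X * (\<nu> + a + 2 + b)))"
    proof -
      have "pochhammer (\<nu> + of_nat (Suc l) + 1) (Suc n) = X * (\<nu> + a + 2 + b)"
        by (simp add: pochhammer_Suc X_def a_def b_def add_ac)
      moreover have "fact (2 * Suc l + 1) = 2*(a+1) * (2*a+3) * f1"
        by (simp add: f1_def a_def algebra_simps)
      moreover have e: "\<nu> + 2 * of_nat (Suc l) + 1 = \<nu> + 2*a + 3" by (simp add: a_def)
      moreover have "Suc l \<le> n" using 3 by simp
      ultimately show ?thesis using coeff_B_pochhammer[of "Suc l" n \<nu>, unfolded e, OF _ nz(3)]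
        by (simp add: a_def P_def f2_def f3_def Q_def del: fact_Suc pochhammer_Suc of_nat_Suc)
    qed
    have A: "coeff_A (Suc n) (Suc l) \<nu> = (2*(b+1)*f2) * (\<nu> + 2*a + 2) * (Q * (2*\<nu> + 2*a + 1)) /
      (4 * P * (2*(a+1) * f1) * ((b-a) * f3) * ((\<nu> + a + 1) * X * (\<nu> + a + 2 + b)))"
    proof -
      have "pochhammer (\<nu> + of_nat (Suc l)) (Suc (Suc n)) = (\<nu> + of_nat l + 1) * pochhammer (\<nu> + of_nat l + 2) (Suc n)"
        unfolding pochhammer_rec[of _ "Suc n"] by (simp add: add_ac)
      then have "pochhammer (\<nu> + of_nat (Suc l)) (Suc (Suc n)) = (\<nu> + a + 1) * X * (\<nu> + a + 2 + b)"
        by (simp add: pochhammer_Suc X_def a_def b_def add_ac)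
      moreover have "fact (2 * Suc l) = 2*(a+1) * f1" "fact (2 * Suc n) = 2*(b+1)*f2"
        by (simp_all add: f1_def f2_def a_def b_def algebra_simps)
      moreover have e: "\<nu> + 2 * of_nat (Suc l) = \<nu> + 2*a + 2" by (simp add: a_def)
      moreover have "fact (Suc n - Suc l) = (b - a) * f3"
        unfolding ba[symmetric] f3_def by (simp add: n)
      moreover have "(2::complex) ^ (2*Suc n - Suc l) = 4 * P"
      proof -
        have "2*Suc n - Suc l = Suc (Suc (2*n - Suc l))" using 3 by simp
        then show ?thesis by (simp add: P_def)
      qed
      moreover have "Suc l \<le> Suc n" using 3 by simp
      ultimately show ?thesis using coeff_A_pochhammer[of "Suc l" "Suc n" \<nu>, unfolded e, OF _ nz(2)]
        by (simp add: a_def Q_def del: fact_Suc pochhammer_Suc of_nat_Suc diff_Suc_Suc)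
    qed
    note e = one_minus_ratio[OF nz(1)]
    have "2*(b+1)*(\<nu> + 2*a + 2) = 2 * ((b-a)*(\<nu> + a + 1) + (a+1) * (\<nu> + a + 2 + b))"
      by (simp add: algebra_simps)
    then have *: "2*(b+1)*(\<nu> + 2*a + 2) / (2*(a+1)*(b-a)*(\<nu> + a + 1)*(\<nu> + a + 2 + b)) =
        1 / ((a+1) * (\<nu> + a + 2 + b)) + 1 / ((b-a)*(\<nu> + a + 1))"
      using az(1) ba0 nz(4,5) by (metis partial_fractions')
    define K where "K = f2 * Q * (2*\<nu> + 2*a + 1) / (4 * P * f1 * f3 * X)"
    have "coeff_A (Suc n) (Suc l) \<nu> = K * (2*(b+1)*(\<nu> + 2*a + 2) / (2*(a+1)*(b-a)*(\<nu> + a + 1)*(\<nu> + a + 2 + b)))"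
      unfolding A K_def by (simp add: mult_ac del: distrib_left_numeral)
    also have "\<dots> = K / ((a+1) * (\<nu> + a + 2 + b)) + K / ((b-a)*(\<nu> + a + 1))"
      unfolding * by (simp add: distrib_left)
    also have "K / ((a+1) * (\<nu> + a + 2 + b)) = coeff_B n (Suc l) \<nu> * (2 * a + 3) / (2 * (\<nu> + 2*a + 3))"
    proof -
      have "f2 * Q * T / (4 * P * f1 * f3 * X) / (u * w) = f2 * D * (Q * T) / (P * (2*u * r * f1) * f3 * (X * w)) * r / (2 * D)"
        if "r \<noteq> 0" "D \<noteq> 0" for T u w D r
        using that by (simp add: mult_ac)
      from this[OF az(2) nz(3)] show ?thesis unfolding B1 K_def by (simp only: times_divide_eq_left)
    qed
    also have "K / ((b-a)*(\<nu> + a + 1)) = coeff_B n l \<nu> * (1 - (2*a + 1) / (2 * (\<nu> + 2*a + 1)))"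
    proof -
      have "f2 * Q * T / (4 * P * f1 * f3 * X) / (c * v) = f2 * D * Q / (2 * P * f1 * (c * f3) * (v * X)) * (T / (2 * D))"
        if "D \<noteq> 0" for T c v D
        using that by (simp add: mult_ac)
      from this[OF nz(1)] show ?thesis unfolding e B0 K_def .
    qed
    finally show ?thesis using 3 by (simp add: a_def algebra_simps)
  qed
qed

subsection \<open>Iterated derivatives from the two relations\<close>

text \<open>\<open>g m\<close> stands for \<open>\<epsilon>\<^sup>m G\<^bsub>\<nu>+m\<^esub> / z\<^sup>\<nu>\<close> or for \<open>z\<^bsup>-\<nu>\<^esup> G\<^bsub>-\<nu>-m\<^esub>\<close>; the powers of \<open>\<epsilon>\<close> make the
  relations of the two cases agree.\<close>
locale shift_family =
  fixes S :: "complex set" and \<epsilon> \<nu> :: complex and g :: "nat \<Rightarrow> complex \<Rightarrow> complex"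
  assumes open_S: "open S" and eps: "\<epsilon> * \<epsilon> = 1"
    and deriv_g: "\<And>m w. w \<in> S \<Longrightarrow> (g m has_field_derivative of_nat m / w * g m w + g (Suc m) w) (at w)"
    and three_term: "\<And>m w. w \<in> S \<Longrightarrow>
      2 * (\<nu> + of_nat (Suc m)) / w * g (Suc m) w = \<epsilon> * g m w - g (Suc (Suc m)) w"
begin

text \<open>The term with 1/w is r times the left side of the three-term relation. Index 0 is left
  out because its derivative has no such term, so that no division by \<nu> occurs.\<close>

lemma deriv_g_shift:
  assumes "w \<in> S" "\<nu> + of_nat (Suc m) \<noteq> 0"
  defines "r \<equiv> of_nat (Suc m) / (2 * (\<nu> + of_nat (Suc m)))"
  shows "(g (Suc m) has_field_derivative \<epsilon> * r * g m w + (1 - r) * g (Suc (Suc m)) w) (at w)"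
proof -
  have "of_nat (Suc m) / w * g (Suc m) w = r * (2 * (\<nu> + of_nat (Suc m)) / w * g (Suc m) w)"
    using assms(2) by (simp add: r_def del: distrib_left_numeral of_nat_Suc)
  also have "\<dots> = \<epsilon> * r * g m w - r * g (Suc (Suc m)) w"
    unfolding three_term[OF assms(1)] by (simp add: algebra_simps)
  finally have "of_nat (Suc m) / w * g (Suc m) w + g (Suc (Suc m)) w = \<epsilon> * r * g m w + (1 - r) * g (Suc (Suc m)) w"
    by (simp add: algebra_simps)
  then show ?thesis using deriv_g[OF assms(1), of "Suc m"] by simp
qed

lemma deriv_even_sum:
  assumes "w \<in> S" "\<nu> \<notin> neg_int_seg (2*n)"
  shows "((\<lambda>w. \<Sum>k\<le>n. \<epsilon>^(n+k) * coeff_A n k \<nu> * g (2*k) w) has_field_derivative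
    (\<Sum>k\<le>n. \<epsilon>^(n+k) * coeff_B n k \<nu> * g (2*k+1) w)) (at w)"
proof -
  define r where "r = (\<lambda>k. of_nat k / (\<nu> + 2 * of_nat k))"
  \<comment> \<open>For k = 0 the index \<open>2*k-1\<close> truncates to 0; this spurious term has
    weight \<open>r 0 = 0\<close>, also when \<nu> = 0.\<close>
  have d: "(g (2*k) has_field_derivative \<epsilon> * r k * g (2*k-1) w + (1 - r k) * g (2*k+1) w) (at w)" if "k \<le> n" for k
  proof (cases k)
    case 0
    then show ?thesis using deriv_g[OF assms(1), of 0] by (simp add: r_def)
  next
    case (Suc l)
    have "\<nu> + of_nat (2 * k) \<noteq> 0" using assms(2) that Suc unfolding not_neg_int_seg_iff by (auto simp del: of_nat_mult of_nat_Suc)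
    moreover have "of_nat (2 * k) / (2 * (\<nu> + of_nat (2 * k))) = r k" by (simp add: r_def del: distrib_left_numeral)
    moreover have "2 * k = Suc (2*k - 1)" using Suc by simp
    ultimately show ?thesis using deriv_g_shift[OF assms(1), of "2*k - 1"] by (simp del: of_nat_Suc of_nat_mult)
  qed
  let ?a = "\<lambda>k. \<epsilon>^(n+k) * coeff_A n k \<nu>"
  have "((\<lambda>w. \<Sum>k\<le>n. ?a k * g (2*k) w) has_field_derivative
    (\<Sum>k\<le>n. ?a k * (\<epsilon> * r k * g (2*k-1) w + (1 - r k) * g (2*k+1) w))) (at w)"
    by (intro DERIV_sum DERIV_cmult d) simp
  also have "(\<Sum>k\<le>n. ?a k * (\<epsilon> * r k * g (2*k-1) w + (1 - r k) * g (2*k+1) w)) =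
     (\<Sum>k\<le>n. ?a k * (1 - r k) * g (2*k+1) w) + (\<Sum>k\<le>n. ?a k * \<epsilon> * r k * g (2*k-1) w)"
    by (simp add: algebra_simps flip: sum.distrib)
  also have "(\<Sum>k\<le>n. ?a k * \<epsilon> * r k * g (2*k-1) w) = (\<Sum>k<n. ?a (Suc k) * \<epsilon> * r (Suc k) * g (2*k+1) w)"
    by (subst sum.atMost_shift) (simp add: r_def)
  also have "\<dots> = (\<Sum>k\<le>n. if k < n then ?a (Suc k) * \<epsilon> * r (Suc k) * g (2*k+1) w else 0)"
    by (rule sum.mono_neutral_cong_left) auto
  also have "(\<Sum>k\<le>n. ?a k * (1 - r k) * g (2*k+1) w) + \<dots> = (\<Sum>k\<le>n. \<epsilon>^(n+k) * coeff_B n k \<nu> * g (2*k+1) w)"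
    unfolding sum.distrib[symmetric]
  proof (rule sum.cong[OF refl])
    fix k assume "k \<in> {..n}"
    then have B: "coeff_B n k \<nu> = coeff_A n k \<nu> * (1 - r k) + (if k < n then coeff_A n (Suc k) \<nu> * r (Suc k) else 0)"
      using coeff_B_from_A[OF assms(2)] by (simp add: r_def)
    \<comment> \<open>The \<epsilon> from the three-term relation and the one from raising k cancel,
      so both contributions carry the same sign.\<close>
    have "\<epsilon> ^ (n + Suc k) * \<epsilon> = \<epsilon> ^ (n+k)" by (simp add: eps mult.commute mult.left_commute)
    then have "?a (Suc k) * \<epsilon> * r (Suc k) = \<epsilon> ^ (n+k) * (coeff_A n (Suc k) \<nu> * r (Suc k))"
      by (metis mult.assoc mult.commute)
    then show "?a k * (1 - r k) * g (2*k+1) w + (if k < n then ?a (Suc k) * \<epsilon> * r (Suc k) * g (2*k+1) w else 0)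
       = \<epsilon>^(n+k) * coeff_B n k \<nu> * g (2*k+1) w"
      unfolding B by (simp add: algebra_simps eps)
  qed
  finally show ?thesis .
qed

lemma deriv_odd_sum:
  assumes "w \<in> S" "\<nu> \<notin> neg_int_seg (2*n+1)"
  shows "((\<lambda>w. \<Sum>k\<le>n. \<epsilon>^(n+k) * coeff_B n k \<nu> * g (2*k+1) w) has_field_derivative
    (\<Sum>k\<le>Suc n. \<epsilon>^(Suc n+k) * coeff_A (Suc n) k \<nu> * g (2*k) w)) (at w)"
proof -
  define r where "r = (\<lambda>k. (2 * of_nat k + 1) / (2 * (\<nu> + 2 * of_nat k + 1)))"
  have d: "(g (2*k+1) has_field_derivative \<epsilon> * r k * g (2*k) w + (1 - r k) * g (2 * Suc k) w) (at w)" if "k \<le> n" for k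
  proof -
    have "\<nu> + of_nat (Suc (2 * k)) \<noteq> 0" using assms(2) that unfolding not_neg_int_seg_iff by (auto simp del: of_nat_mult of_nat_Suc)
    moreover have "of_nat (Suc (2 * k)) / (2 * (\<nu> + of_nat (Suc (2 * k)))) = r k" by (simp add: r_def add_ac)
    ultimately show ?thesis using deriv_g_shift[OF assms(1), of "2*k"] by (simp del: of_nat_Suc of_nat_mult)
  qed
  let ?b = "\<lambda>k. \<epsilon>^(n+k) * coeff_B n k \<nu>"
  have "((\<lambda>w. \<Sum>k\<le>n. ?b k * g (2*k+1) w) has_field_derivative
    (\<Sum>k\<le>n. ?b k * (\<epsilon> * r k * g (2*k) w + (1 - r k) * g (2 * Suc k) w))) (at w)"
    by (intro DERIV_sum DERIV_cmult d) simp
  also have "(\<Sum>k\<le>n. ?b k * (\<epsilon> * r k * g (2*k) w + (1 - r k) * g (2 * Suc k) w)) =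
     (\<Sum>k\<le>n. ?b k * \<epsilon> * r k * g (2*k) w) + (\<Sum>k\<le>n. ?b k * (1 - r k) * g (2 * Suc k) w)"
    by (simp add: algebra_simps flip: sum.distrib)
  also have "(\<Sum>k\<le>n. ?b k * \<epsilon> * r k * g (2*k) w) = (\<Sum>k\<le>Suc n. if k \<le> n then ?b k * \<epsilon> * r k * g (2*k) w else 0)"
    by simp
  also have "(\<Sum>k\<le>n. ?b k * (1 - r k) * g (2 * Suc k) w) =
     (\<Sum>k\<le>Suc n. case k of 0 \<Rightarrow> 0 | Suc l \<Rightarrow> ?b l * (1 - r l) * g (2 * Suc l) w)"
    by (simp only: sum.atMost_Suc_shift nat.case add_0_left)
  also have "(\<Sum>k\<le>Suc n. if k \<le> n then ?b k * \<epsilon> * r k * g (2*k) w else 0) + \<dots> =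
    (\<Sum>k\<le>Suc n. \<epsilon>^(Suc n+k) * coeff_A (Suc n) k \<nu> * g (2*k) w)"
    unfolding sum.distrib[symmetric]
  proof (rule sum.cong[OF refl])
    fix k assume "k \<in> {..Suc n}"
    then have A: "coeff_A (Suc n) k \<nu> = (if k \<le> n then coeff_B n k \<nu> * r k else 0) +
        (case k of 0 \<Rightarrow> 0 | Suc l \<Rightarrow> coeff_B n l \<nu> * (1 - r l))"
      using coeff_A_Suc_from_B[OF assms(2), of k] by (cases k) (simp_all add: r_def)
    have e: "\<epsilon> ^ (Suc n + Suc l) = \<epsilon> ^ (n + l)" for l by (simp add: eps mult.assoc[symmetric])
    show "(if k \<le> n then ?b k * \<epsilon> * r k * g (2*k) w else 0) +
       (case k of 0 \<Rightarrow> 0 | Suc l \<Rightarrow> ?b l * (1 - r l) * g (2 * Suc l) w) =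
       \<epsilon>^(Suc n+k) * coeff_A (Suc n) k \<nu> * g (2*k) w"
      unfolding A using e by (auto simp: algebra_simps split: nat.split simp del: power_Suc)
        (auto simp: algebra_simps)
  qed
  finally show ?thesis .
qed

text \<open>Equality is carried along on all of S, since the next derivative depends on a
  neighbourhood of the point. Passing from order m to m+1 involves the indices up to m and so
  excludes -1, ..., -m only; order 0 needs nothing, in accordance with
  \<open>2*0 - 1 = 0\<close>.\<close>

lemma higher_deriv:
  shows "\<nu> \<notin> neg_int_seg (2*n - 1) \<Longrightarrow> w \<in> S \<Longrightarrow>
      (deriv ^^ (2*n)) (g 0) w = (\<Sum>k\<le>n. \<epsilon>^(n+k) * coeff_A n k \<nu> * g (2*k) w)"
    and "\<nu> \<notin> neg_int_seg (2*n) \<Longrightarrow> w \<in> S \<Longrightarrow>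
      (deriv ^^ (2*n+1)) (g 0) w = (\<Sum>k\<le>n. \<epsilon>^(n+k) * coeff_B n k \<nu> * g (2*k+1) w)"
proof -
  have sub: "\<nu> \<notin> neg_int_seg M" if "\<nu> \<notin> neg_int_seg N" "M \<le> N" for M N
    using that unfolding not_neg_int_seg_iff by (meson le_trans)
  have step: "deriv f v = f' v"
    if "v \<in> S" "\<And>u. u \<in> S \<Longrightarrow> f u = h u" "(h has_field_derivative f' v) (at v)" for f h f' v
  proof -
    have "(f has_field_derivative f' v) (at v)"
      by (rule has_field_derivative_transform_within_open[OF that(3) open_S that(1)]) (simp add: that(2))
    then show ?thesis by (rule DERIV_imp_deriv)
  qed
  let ?E = "\<lambda>n w. \<Sum>k\<le>n. \<epsilon>^(n+k) * coeff_A n k \<nu> * g (2*k) w"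
  let ?O = "\<lambda>n w. \<Sum>k\<le>n. \<epsilon>^(n+k) * coeff_B n k \<nu> * g (2*k+1) w"
  have odd: "\<forall>w\<in>S. (deriv ^^ (2*n+1)) (g 0) w = ?O n w"
    if "\<nu> \<notin> neg_int_seg (2*n)" "\<forall>w\<in>S. (deriv ^^ (2*n)) (g 0) w = ?E n w" for n
    using step[where f = "(deriv ^^ (2*n)) (g 0)" and h = "?E n" and f' = "?O n"] that deriv_even_sum by simp
  have even: "\<nu> \<notin> neg_int_seg (2*n - 1) \<Longrightarrow> \<forall>w\<in>S. (deriv ^^ (2*n)) (g 0) w = ?E n w" for n
  proof (induction n)
    case 0
    then show ?case by (simp add: coeff_A_def)
  next
    case (Suc n)
    then have nu: "\<nu> \<notin> neg_int_seg (2*n+1)" by simp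
    then have "\<forall>w\<in>S. (deriv ^^ (2*n+1)) (g 0) w = ?O n w"
      by (intro odd Suc.IH; intro sub[OF nu]; simp)
    then show ?case
      using step[where f = "(deriv ^^ (2*n+1)) (g 0)" and h = "?O n" and f' = "?E (Suc n)"] deriv_odd_sum[OF _ nu] by simp
  qed
  show "\<nu> \<notin> neg_int_seg (2*n - 1) \<Longrightarrow> w \<in> S \<Longrightarrow> (deriv ^^ (2*n)) (g 0) w = ?E n w"
    using even by blast
  show "\<nu> \<notin> neg_int_seg (2*n) \<Longrightarrow> w \<in> S \<Longrightarrow> (deriv ^^ (2*n+1)) (g 0) w = ?O n w"
    using odd[OF _ even] sub[of "2*n" "2*n-1"] by simp
qed

end

subsection \<open>The first solutions\<close>

text \<open>The Bessel-Clifford function, entire in both variables: J and I are (z/2)^\<mu> times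
  its value at -z^2/4 and z^2/4.\<close>

definition bessel_series :: "complex \<Rightarrow> complex \<Rightarrow> complex" where
  "bessel_series \<mu> x = (\<Sum>m. x ^ m * rGamma (\<mu> + of_nat m + 1) / fact m)"

text \<open>Since 1/\<Gamma>(s) = s/\<Gamma>(s+1), a unit shift does not increase the modulus once
  Re s is at least 1; the finitely many earlier shifts stay in a compact disc. A bound independent
  of m gives the series an exponential majorant, uniform in the order.\<close>

lemma rGamma_shift_bounded:
  obtains C where "0 \<le> C"
    "\<And>(m::nat) \<mu>::complex. norm \<mu> \<le> R \<Longrightarrow> norm (rGamma (\<mu> + of_nat m + 1)) \<le> C"
proof -
  obtain M :: nat where M: "R \<le> real M" using real_arch_simple by blast
  have "bounded (rGamma ` cball (0::complex) (R + M + 1))"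
    by (intro compact_imp_bounded compact_continuous_image continuous_on_rGamma compact_cball)
  then obtain C where C: "0 < C" "\<And>s. norm s \<le> R + M + 1 \<Longrightarrow> norm (rGamma (s::complex)) \<le> C"
    by (auto simp: bounded_pos)
  have "norm (rGamma (\<mu> + of_nat m + 1)) \<le> C" if \<mu>: "norm \<mu> \<le> R" for m :: nat and \<mu> :: complex
  proof (induction m)
    case 0
    have "norm (\<mu> + 1) \<le> norm \<mu> + 1" by (metis norm_one norm_triangle_ineq)
    with \<mu> C(2)[of "\<mu> + 1"] show ?case by simp
  next
    case (Suc m)
    show ?case
    proof (cases "Suc m \<le> M")
      case True
      have "norm (\<mu> + of_nat (Suc m) + 1) \<le> norm \<mu> + norm (of_nat (Suc m) :: complex) + norm (1::complex)"
        by (meson norm_triangle_mono norm_triangle_ineq order_refl)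
      also have "\<dots> \<le> R + M + 1" using True \<mu> by (simp only: norm_of_nat norm_one)
      finally show ?thesis by (rule C(2))
    next
      case False
      let ?s = "\<mu> + of_nat m + 1"
      have "1 \<le> Re ?s" using False M \<mu> abs_Re_le_cmod[of \<mu>] by simp
      then have "1 \<le> norm ?s" using complex_Re_le_cmod[of ?s] by linarith
      have "norm (rGamma (?s + 1)) \<le> norm ?s * norm (rGamma (?s + 1))"
        using \<open>1 \<le> norm ?s\<close> by (simp add: mult_le_cancel_right1)
      also have "\<dots> = norm (rGamma ?s)" by (simp only: rGamma_plus1 flip: norm_mult)
      finally show ?thesis using Suc by (simp add: add_ac)
    qed
  qed
  with C(1) that show thesis by (metis less_imp_le)
qed

lemma bessel_series_term_bounded:
  obtains C where "0 \<le> C"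
    "\<And>(\<mu>::complex) (x::complex) m. norm \<mu> \<le> R \<Longrightarrow> norm x \<le> X \<Longrightarrow> norm (x ^ m * rGamma (\<mu> + of_nat m + 1) / fact m) \<le> C * (X ^ m / fact m)"
proof -
  obtain C where C: "0 \<le> C"
    "\<And>(m::nat) \<mu>::complex. norm \<mu> \<le> R \<Longrightarrow> norm (rGamma (\<mu> + of_nat m + 1)) \<le> C"
    using rGamma_shift_bounded by blast
  have "norm (x ^ m * rGamma (\<mu> + of_nat m + 1) / fact m) \<le> C * (X ^ m / fact m)"
    if "norm \<mu> \<le> R" "norm x \<le> X" for \<mu> x :: complex and m
  proof -
    have "norm (x ^ m * rGamma (\<mu> + of_nat m + 1) / fact m) = norm (rGamma (\<mu> + of_nat m + 1)) * (norm x ^ m / fact m)"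
      by (simp add: norm_mult norm_divide norm_power)
    also have "\<dots> \<le> C * (X ^ m / fact m)"
      using that C by (intro mult_mono divide_right_mono power_mono) auto
    finally show ?thesis .
  qed
  with C(1) that show thesis by blast
qed

lemma summable_const_exp: "summable (\<lambda>m. C * (X ^ m / fact m))" for X :: real
  using summable_exp[of X] by (intro summable_mult) (simp add: field_simps)

lemma summable_bessel_series: "summable (\<lambda>m. x ^ m * rGamma (\<mu> + of_nat m + 1) / fact m)" for x \<mu> :: complex
proof -
  obtain C where "\<And>m. norm (x ^ m * rGamma (\<mu> + of_nat m + 1) / fact m) \<le> C * (norm x ^ m / fact m)"
    using bessel_series_term_bounded[of "norm \<mu>" "norm x"] by (metis order_refl)
  then show ?thesis by (intro summable_comparison_test'[OF summable_const_exp])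
qed

lemma bessel_series_bounded:
  obtains B where "\<And>\<mu> x. norm \<mu> \<le> R \<Longrightarrow> norm x \<le> X \<Longrightarrow> norm (bessel_series \<mu> x) \<le> B"
proof -
  obtain C where C:
    "\<And>(\<mu>::complex) (x::complex) m. norm \<mu> \<le> R \<Longrightarrow> norm x \<le> X \<Longrightarrow> norm (x ^ m * rGamma (\<mu> + of_nat m + 1) / fact m) \<le> C * (X ^ m / fact m)"
    using bessel_series_term_bounded[of R X] by metis
  have "norm (bessel_series \<mu> x) \<le> (\<Sum>m. C * (X ^ m / fact m))" if "norm \<mu> \<le> R" "norm x \<le> X" for \<mu> x
    unfolding bessel_series_def by (rule norm_suminf_le[OF C[OF that] summable_const_exp])
  with that show thesis by blast
qed

text \<open>The partial sums are entire in \<mu> and converge locally uniformly by the exponential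
  majorant. Holomorphy in the order is what makes the limits at integer order accessible.\<close>

lemma bessel_series_holomorphic_order: "(\<lambda>\<mu>. bessel_series \<mu> x) holomorphic_on UNIV"
proof (rule holomorphic_uniform_sequence[OF open_UNIV])
  show "(\<lambda>\<mu>. \<Sum>m<n. x ^ m * rGamma (\<mu> + of_nat m + 1) / fact m) holomorphic_on UNIV" for n
    by (intro holomorphic_intros) auto
  fix \<mu>0 :: complex
  obtain C where C:
    "\<And>\<mu> m. norm \<mu> \<le> norm \<mu>0 + 1 \<Longrightarrow> norm (x ^ m * rGamma (\<mu> + of_nat m + 1) / fact m) \<le> C * (norm x ^ m / fact m)"
    using bessel_series_term_bounded[of "norm \<mu>0 + 1" "norm x"] by (metis order_refl)
  have "norm \<mu> \<le> norm \<mu>0 + 1" if "\<mu> \<in> cball \<mu>0 1" for \<mu>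
    using that norm_triangle_ineq2[of \<mu> \<mu>0] by (simp add: dist_norm norm_minus_commute)
  then have "uniform_limit (cball \<mu>0 1) (\<lambda>n \<mu>. \<Sum>m<n. x ^ m * rGamma (\<mu> + of_nat m + 1) / fact m)
      (\<lambda>\<mu>. bessel_series \<mu> x) sequentially"
    unfolding bessel_series_def
    by (intro Weierstrass_m_test[OF _ summable_const_exp[of C "norm x"]] C)
  then show "\<exists>d>0. cball \<mu>0 d \<subseteq> UNIV \<and> uniform_limit (cball \<mu>0 d)
      (\<lambda>n \<mu>. \<Sum>m<n. x ^ m * rGamma (\<mu> + of_nat m + 1) / fact m) (\<lambda>\<mu>. bessel_series \<mu> x) sequentially"
    by (intro exI[of _ 1]) simp
qed

lemma bessel_series_deriv: "((\<lambda>x. bessel_series \<mu> x) has_field_derivative bessel_series (\<mu> + 1) x) (at x)"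
proof -
  define c where "c = (\<lambda>m. rGamma (\<mu> + of_nat m + 1) / fact m)"
  have e: "bessel_series \<mu> = (\<lambda>x. \<Sum>m. c m * x ^ m)"
    by (simp add: bessel_series_def c_def mult.commute fun_eq_iff)
  have "summable (\<lambda>m. c m * y ^ m)" for y
    using summable_bessel_series[of y \<mu>] by (simp add: c_def mult.commute)
  then have "((\<lambda>x. \<Sum>m. c m * x ^ m) has_field_derivative (\<Sum>m. diffs c m * x ^ m)) (at x)"
    by (rule termdiffs_strong_converges_everywhere)
  moreover have "diffs c m * x ^ m = x ^ m * rGamma (\<mu> + 1 + of_nat m + 1) / fact m" for m
  proof -
    have "\<mu> + of_nat (Suc m) + 1 = \<mu> + 1 + of_nat m + 1" by simp
    then show ?thesis by (simp add: diffs_def c_def del: of_nat_Suc)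
  qed
  ultimately show ?thesis by (simp add: e bessel_series_def)
qed

text \<open>By 1/\<Gamma>(\<mu>+m) = (\<mu>+m)/\<Gamma>(\<mu>+m+1), subtracting \<mu> times the
  series from the one of order \<mu>-1 leaves m times each coefficient. The term m = 0 drops out,
  and an index shift produces x times the series of order \<mu>+1.\<close>

lemma bessel_series_contiguous:
  "bessel_series (\<mu> - 1) x - x * bessel_series (\<mu> + 1) x = \<mu> * bessel_series \<mu> x"
proof -
  define t where "t = (\<lambda>m. x ^ m * rGamma (\<mu> + of_nat m) / fact m - \<mu> * (x ^ m * rGamma (\<mu> + of_nat m + 1) / fact m))"
  have S: "(\<lambda>m. x ^ m * rGamma (\<mu> + of_nat m) / fact m) sums bessel_series (\<mu> - 1) x"
    "(\<lambda>m. x ^ m * rGamma (\<mu> + of_nat m + 1) / fact m) sums bessel_series \<mu> x"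
    "(\<lambda>m. x ^ m * rGamma (\<mu> + of_nat m + 2) / fact m) sums bessel_series (\<mu> + 1) x"
    using summable_sums[OF summable_bessel_series[of x "\<mu> - 1"]] summable_sums[OF summable_bessel_series[of x \<mu>]]
      summable_sums[OF summable_bessel_series[of x "\<mu> + 1"]]
    by (simp_all add: bessel_series_def add_ac)
  have t: "t m = of_nat m * x ^ m * rGamma (\<mu> + of_nat m + 1) / fact m" for m
  proof -
    have "rGamma (\<mu> + of_nat m) = (\<mu> + of_nat m) * rGamma (\<mu> + of_nat m + 1)" by (simp add: rGamma_plus1)
    then show ?thesis by (simp add: t_def field_simps)
  qed
  have "t sums (bessel_series (\<mu> - 1) x - \<mu> * bessel_series \<mu> x)"
    unfolding t_def by (intro sums_diff sums_mult S)
  then have "(\<lambda>m. t (Suc m)) sums (bessel_series (\<mu> - 1) x - \<mu> * bessel_series \<mu> x)"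
    by (subst sums_Suc_iff) (simp add: t)
  moreover have "t (Suc m) = x * (x ^ m * rGamma (\<mu> + of_nat m + 2) / fact m)" for m
  proof -
    have "\<mu> + of_nat (Suc m) + 1 = \<mu> + of_nat m + 2" by simp
    moreover have "of_nat (Suc m) \<noteq> (0::complex)" by (simp only: of_nat_eq_0_iff)
    ultimately show ?thesis unfolding t by (simp only: fact_Suc of_nat_mult of_nat_fact power_Suc) (simp del: of_nat_Suc)
  qed
  ultimately have "(\<lambda>m. x * (x ^ m * rGamma (\<mu> + of_nat m + 2) / fact m)) sums (bessel_series (\<mu> - 1) x - \<mu> * bessel_series \<mu> x)"
    by simp
  with sums_mult[OF S(3), of x] have "x * bessel_series (\<mu> + 1) x = bessel_series (\<mu> - 1) x - \<mu> * bessel_series \<mu> x"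
    using sums_unique2 by blast
  then show ?thesis by simp
qed

text \<open>A Schwarz-type estimate: the difference quotient at c, completed by the derivative, is
  holomorphic, and on the circle it is at most 2B/r because B bounds h at the centre as well. The
  constant depends only on B and r, so a bound uniform in a parameter gives convergence uniform in
  it.\<close>

lemma holomorphic_diff_bound:
  assumes h: "h holomorphic_on ball c R" and r: "0 < r" "r < R"
    and B: "\<And>\<mu>. norm (\<mu> - c) = r \<Longrightarrow> norm (h \<mu>) \<le> B" and \<mu>: "norm (\<mu> - c) < r"
  shows "norm (h \<mu> - h c) \<le> 2 * B / r * norm (\<mu> - c)"
proof -
  define k where "k = (\<lambda>z. if z = c then deriv h c else (h z - h c) / (z - c))"
  have max: "norm (f \<xi>) \<le> C" if "f holomorphic_on ball c R" "\<And>\<mu>. norm (\<mu> - c) = r \<Longrightarrow> norm (f \<mu>) \<le> C"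
    "norm (\<xi> - c) \<le> r" for f \<xi> C
  proof (rule maximum_modulus_frontier[of f "cball c r"])
    have sub: "cball c r \<subseteq> ball c R" using r by auto
    then show "f holomorphic_on interior (cball c r)"
      using that(1) by (metis holomorphic_on_subset interior_subset subset_trans)
    show "continuous_on (closure (cball c r)) f"
      using continuous_on_subset[OF holomorphic_on_imp_continuous_on[OF that(1)] sub] by simp
  qed (use that in \<open>auto simp: dist_norm norm_minus_commute\<close>)
  have hc: "norm (h c) \<le> B" using max[OF h B, of c] r by simp
  have k: "k holomorphic_on ball c R" unfolding k_def by (intro pole_lemma_open h open_ball)
  have kB: "norm (k z) \<le> 2 * B / r" if "norm (z - c) = r" for z
  proof -
    have "norm (h z - h c) \<le> 2 * B" using norm_triangle_ineq4[of "h z" "h c"] B[OF that] hc by linarith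
    with that r show ?thesis by (auto simp: k_def norm_divide divide_right_mono)
  qed
  have "norm (k \<mu>) \<le> 2 * B / r" using max[OF k kB, of \<mu>] \<mu> by simp
  moreover have "h \<mu> - h c = k \<mu> * (\<mu> - c)" by (simp add: k_def)
  ultimately show ?thesis by (metis norm_mult mult_right_mono norm_ge_zero)
qed

section \<open>Families satisfying both relations, and powers on a branch of the logarithm\<close>

definition bessel_family :: "complex \<Rightarrow> complex set \<Rightarrow> (complex \<Rightarrow> complex \<Rightarrow> complex) \<Rightarrow> bool" where
  "bessel_family s S G \<longleftrightarrow> (\<forall>\<mu>. \<forall>w\<in>S.
     (G \<mu> has_field_derivative \<mu> / w * G \<mu> w + s * G (\<mu> + 1) w) (at w) \<and>
     G (\<mu> - 1) w - s * G (\<mu> + 1) w = 2 * \<mu> / w * G \<mu> w)"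

lemma bessel_familyD:
  assumes "bessel_family s S G" "w \<in> S"
  shows "(G \<mu> has_field_derivative \<mu> / w * G \<mu> w + s * G (\<mu> + 1) w) (at w)"
    and "G (\<mu> - 1) w - s * G (\<mu> + 1) w = 2 * \<mu> / w * G \<mu> w"
  using assms by (auto simp: bessel_family_def)

text \<open>The relations connect different orders, so x and y must be constant in the order as well
  as in the argument: exactly the condition imposed on the coefficients of a linear
  combination.\<close>

lemma bessel_family_lincomb:
  assumes "bessel_family s S G" "bessel_family s S H"
  shows "bessel_family s S (\<lambda>\<mu> w. x * G \<mu> w + y * H \<mu> w)"
  unfolding bessel_family_def
proof (intro allI ballI conjI)
  fix \<mu> w assume w: "w \<in> S"
  note G = bessel_familyD[OF assms(1) w] and H = bessel_familyD[OF assms(2) w]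
  have "((\<lambda>w. x * G \<mu> w + y * H \<mu> w) has_field_derivative
    x * (\<mu> / w * G \<mu> w + s * G (\<mu> + 1) w) + y * (\<mu> / w * H \<mu> w + s * H (\<mu> + 1) w)) (at w)"
    by (intro DERIV_add DERIV_cmult G H)
  then show "((\<lambda>w. x * G \<mu> w + y * H \<mu> w) has_field_derivative
    \<mu> / w * (x * G \<mu> w + y * H \<mu> w) + s * (x * G (\<mu> + 1) w + y * H (\<mu> + 1) w)) (at w)"
    by (simp add: algebra_simps)
  have "x * (G (\<mu> - 1) w - s * G (\<mu> + 1) w) + y * (H (\<mu> - 1) w - s * H (\<mu> + 1) w)
     = x * (2 * \<mu> / w * G \<mu> w) + y * (2 * \<mu> / w * H \<mu> w)"
    by (simp only: G(2) H(2))
  then show "x * G (\<mu> - 1) w + y * H (\<mu> - 1) w - s * (x * G (\<mu> + 1) w + y * H (\<mu> + 1) w)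
     = 2 * \<mu> / w * (x * G \<mu> w + y * H \<mu> w)"
    by (simp add: algebra_simps)
qed

context
  fixes L :: "complex \<Rightarrow> complex" and S :: "complex set"
  assumes L: "log_branch L S"
begin

lemma open_branch: "open S" and holomorphic_branch: "L holomorphic_on S"
  and exp_branch: "w \<in> S \<Longrightarrow> exp (L w) = w"
  using L by (auto simp: log_branch_def)

lemma branch_nonzero: "w \<in> S \<Longrightarrow> w \<noteq> 0"
  using exp_branch[of w] exp_not_eq_zero[of "L w"] by auto

lemma deriv_branch:
  assumes "w \<in> S"
  shows "(L has_field_derivative 1 / w) (at w)"
proof -
  have d: "(L has_field_derivative deriv L w) (at w)"
    using holomorphic_derivI[OF holomorphic_branch open_branch assms] .
  have "((\<lambda>z. exp (L z)) has_field_derivative exp (L w) * deriv L w) (at w)"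
    by (rule DERIV_chain2[OF DERIV_exp d])
  moreover have "((\<lambda>z. exp (L z)) has_field_derivative 1) (at w)"
    by (rule has_field_derivative_transform_within_open[OF DERIV_ident open_branch assms]) (simp add: exp_branch)
  ultimately have "exp (L w) * deriv L w = 1" by (rule DERIV_unique)
  then have "deriv L w = 1 / w"
    using assms branch_nonzero[OF assms] by (simp add: exp_branch field_simps)
  with d show ?thesis by simp
qed

lemma deriv_branch_pow:
  assumes "w \<in> S"
  shows "(branch_pow L \<mu> has_field_derivative \<mu> / w * branch_pow L \<mu> w) (at w)"
proof -
  have "((\<lambda>z. exp (\<mu> * L z)) has_field_derivative exp (\<mu> * L w) * (\<mu> * (1 / w))) (at w)"
    by (rule DERIV_chain2[OF DERIV_exp DERIV_cmult[OF deriv_branch[OF assms]]])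
  then show ?thesis by (simp add: branch_pow_def[abs_def] mult.commute)
qed

lemma branch_pow_add_1:
  assumes "w \<in> S"
  shows "branch_pow L (\<mu> + 1) w = w * branch_pow L \<mu> w"
proof -
  have "(\<mu> + 1) * L w = L w + \<mu> * L w" by (simp add: algebra_simps)
  then show ?thesis by (simp only: branch_pow_def exp_add exp_branch[OF assms])
qed

end

section \<open>J and I as one function with a sign parameter\<close>

definition bessel_fun :: "complex \<Rightarrow> (complex \<Rightarrow> complex) \<Rightarrow> complex \<Rightarrow> complex \<Rightarrow> complex" where
  "bessel_fun s L \<mu> w = branch_pow L \<mu> w / 2 powr \<mu> * bessel_series \<mu> (s * (w\<^sup>2 / 4))"

lemma bessel_J_eq: "bessel_J L = bessel_fun (-1) L"
  by (simp add: fun_eq_iff bessel_J_def bessel_fun_def bessel_series_def power_minus[of "_ / 4"])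

lemma bessel_I_eq: "bessel_I L = bessel_fun 1 L"
  by (simp add: fun_eq_iff bessel_I_def bessel_fun_def bessel_series_def)

text \<open>Differentiating the power gives \<mu>/w; differentiating the series raises its order and
  brings out s*w/2, which is s times the step from the power of order \<mu> to that of order
  \<mu>+1. The second relation is \<open>bessel_series_contiguous\<close> multiplied by 2/w and the
  power.\<close>

lemma bessel_fun_family:
  assumes L: "log_branch L S"
  shows "bessel_family s S (bessel_fun s L)"
  unfolding bessel_family_def
proof (intro allI ballI conjI)
  fix \<mu> w assume w: "w \<in> S"
  define P where "P = (\<lambda>\<mu> w. branch_pow L \<mu> w / 2 powr \<mu>)"
  let ?x = "s * (w\<^sup>2 / 4)"
  have P1: "P (\<mu> + 1) w = w / 2 * P \<mu> w" for \<mu>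
    using branch_pow_add_1[OF L w, of \<mu>] by (simp add: P_def powr_add)
  have F: "bessel_fun s L = (\<lambda>\<mu> w. P \<mu> w * bessel_series \<mu> (s * (w\<^sup>2 / 4)))"
    by (simp add: fun_eq_iff bessel_fun_def P_def)
  have "(P \<mu> has_field_derivative \<mu> / w * P \<mu> w) (at w)"
    using DERIV_cdivide[OF deriv_branch_pow[OF L w, of \<mu>], of "2 powr \<mu>"] by (simp add: P_def)
  moreover have "((\<lambda>w. bessel_series \<mu> (s * (w\<^sup>2 / 4))) has_field_derivative bessel_series (\<mu> + 1) ?x * (s * (w / 2))) (at w)"
    by (rule DERIV_chain2[OF bessel_series_deriv]) (auto intro!: derivative_eq_intros)
  ultimately have "(bessel_fun s L \<mu> has_field_derivative
     \<mu> / w * P \<mu> w * bessel_series \<mu> ?x + bessel_series (\<mu> + 1) ?x * (s * (w / 2)) * P \<mu> w) (at w)"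
    unfolding F by (rule DERIV_mult)
  then show "(bessel_fun s L \<mu> has_field_derivative \<mu> / w * bessel_fun s L \<mu> w + s * bessel_fun s L (\<mu> + 1) w) (at w)"
    by (simp add: F P1 mult_ac)
  have Pm: "P (\<mu> - 1) w = 2 / w * P \<mu> w"
    using P1[of "\<mu> - 1"] branch_nonzero[OF L w] by (simp add: field_simps)
  have c: "s * (w / 2) = ?x * (2 / w)"
    using branch_nonzero[OF L w] by (simp add: power2_eq_square)
  have "bessel_fun s L (\<mu> - 1) w - s * bessel_fun s L (\<mu> + 1) w
     = 2 / w * P \<mu> w * bessel_series (\<mu> - 1) ?x - (s * (w / 2)) * P \<mu> w * bessel_series (\<mu> + 1) ?x"
    by (simp add: F P1 Pm mult_ac)
  also have "\<dots> = 2 / w * P \<mu> w * (bessel_series (\<mu> - 1) ?x - ?x * bessel_series (\<mu> + 1) ?x)"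
    unfolding c by (simp add: algebra_simps)
  also have "\<dots> = 2 * \<mu> / w * bessel_fun s L \<mu> w"
    unfolding bessel_series_contiguous F by simp
  finally show "bessel_fun s L (\<mu> - 1) w - s * bessel_fun s L (\<mu> + 1) w = 2 * \<mu> / w * bessel_fun s L \<mu> w" .
qed

lemma bessel_fun_holomorphic_order: "(\<lambda>\<mu>. bessel_fun s L \<mu> w) holomorphic_on UNIV"
proof -
  have "(\<lambda>\<mu>. exp (\<mu> * L w) / 2 powr \<mu> * bessel_series \<mu> (s * (w\<^sup>2 / 4))) holomorphic_on UNIV"
    by (intro holomorphic_intros bessel_series_holomorphic_order) auto
  then show ?thesis by (simp add: bessel_fun_def[abs_def] branch_pow_def)
qed

lemma bessel_fun_bounded:
  assumes L: "log_branch L S" and K: "compact K" "K \<subseteq> S"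
  obtains B where "\<And>\<mu> w. norm \<mu> \<le> R \<Longrightarrow> w \<in> K \<Longrightarrow> norm (bessel_fun s L \<mu> w) \<le> B"
proof -
  have "continuous_on K L" "continuous_on K (\<lambda>w. s * (w\<^sup>2 / 4))"
    using continuous_on_subset[OF holomorphic_on_imp_continuous_on[OF holomorphic_branch[OF L]] K(2)]
    by (auto intro!: continuous_intros)
  then have "bounded (L ` K)" "bounded ((\<lambda>w. s * (w\<^sup>2 / 4)) ` K)"
    using K(1) by (auto intro: compact_imp_bounded compact_continuous_image)
  then obtain M X where M: "\<And>w. w \<in> K \<Longrightarrow> norm (L w) \<le> M" and X: "\<And>w. w \<in> K \<Longrightarrow> norm (s * (w\<^sup>2 / 4)) \<le> X"
    unfolding bounded_iff by (metis imageI)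
  obtain B where B: "\<And>\<mu> x. norm \<mu> \<le> R \<Longrightarrow> norm x \<le> X \<Longrightarrow> norm (bessel_series \<mu> x) \<le> B"
    using bessel_series_bounded[of R X] by metis
  have "norm (bessel_fun s L \<mu> w) \<le> exp (R * (M + norm (ln 2 :: complex))) * B" if "norm \<mu> \<le> R" "w \<in> K" for \<mu> w
  proof -
    have "bessel_fun s L \<mu> w = exp (\<mu> * (L w - ln 2)) * bessel_series \<mu> (s * (w\<^sup>2 / 4))"
      by (simp add: bessel_fun_def branch_pow_def powr_def exp_diff right_diff_distrib)
    moreover have "norm (exp (\<mu> * (L w - ln 2))) \<le> exp (R * (M + norm (ln 2 :: complex)))"
    proof -
      have "norm (L w - ln 2) \<le> M + norm (ln 2 :: complex)"
        using norm_triangle_ineq4[of "L w" "ln 2"] M[OF that(2)] by linarith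
      then have "norm (\<mu> * (L w - ln 2)) \<le> R * (M + norm (ln 2 :: complex))"
        unfolding norm_mult using that(1) by (intro mult_mono) (auto intro: order_trans[OF norm_ge_zero])
      then show ?thesis using norm_exp[of "\<mu> * (L w - ln 2)"] by (meson exp_le_cancel_iff order_trans)
    qed
    moreover have "norm (bessel_series \<mu> (s * (w\<^sup>2 / 4))) \<le> B" using B that X by blast
    ultimately show ?thesis by (simp only: norm_mult) (intro mult_mono; simp)
  qed
  with that show thesis by blast
qed

subsection \<open>The second solutions\<close>

text \<open>\<open>Y\<close> and \<open>exp (\<nu>\<pi>\<i>) K\<close> are instances of one construction, for \<open>s = -1\<close> and \<open>s = 1\<close>
  respectively: the assumptions say that \<open>\<alpha> / sin (\<mu>\<pi>)\<close> has period 1, that \<open>\<beta> / sin (\<mu>\<pi>)\<close> is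
  multiplied by \<open>s\<close> under \<open>\<mu> \<mapsto> \<mu> + 1\<close>, and that the numerator vanishes at order 0.\<close>
locale second_solution =
  fixes L :: "complex \<Rightarrow> complex" and S :: "complex set" and s :: complex and \<alpha> \<beta> :: "complex \<Rightarrow> complex"
  assumes L: "log_branch L S" and s: "s * s = 1"
    and hol: "\<alpha> holomorphic_on UNIV" "\<beta> holomorphic_on UNIV"
    and shift: "\<And>\<mu>. \<alpha> (\<mu> + 1) = - \<alpha> \<mu>" "\<And>\<mu>. \<beta> (\<mu> + 1) = - s * \<beta> \<mu>"
    and at_0: "\<alpha> 0 + \<beta> 0 = 0"
begin

definition num :: "complex \<Rightarrow> complex \<Rightarrow> complex" where
  "num \<mu> w = \<alpha> \<mu> * bessel_fun s L \<mu> w + \<beta> \<mu> * bessel_fun s L (- \<mu>) w"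

definition quo :: "complex \<Rightarrow> complex \<Rightarrow> complex" where
  "quo \<mu> w = num \<mu> w / sin (\<mu> * of_real pi)"

definition sol :: "complex \<Rightarrow> complex \<Rightarrow> complex" where
  "sol \<nu> w = (if \<nu> \<in> \<int> then Lim (at \<nu>) (\<lambda>\<mu>. quo \<mu> w) else quo \<nu> w)"

lemma shift_back: "\<alpha> (\<mu> - 1) = - \<alpha> \<mu>" "\<beta> (\<mu> - 1) = - s * \<beta> \<mu>"
proof -
  show "\<alpha> (\<mu> - 1) = - \<alpha> \<mu>" using shift(1)[of "\<mu> - 1"] by simp
  have "s * \<beta> \<mu> = - ((s * s) * \<beta> (\<mu> - 1))" using shift(2)[of "\<mu> - 1"] by simp
  then show "\<beta> (\<mu> - 1) = - s * \<beta> \<mu>" by (simp add: s)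
qed

text \<open>The numerator obeys both relations with the shifted terms reversed in sign; division by
  the sine, which changes sign under unit shifts, repairs this. The part of order -\<mu> moves in
  the opposite direction, so its derivative is turned around by the three-term relation.\<close>

lemma num_family:
  assumes w: "w \<in> S"
  shows "(num \<mu> has_field_derivative \<mu> / w * num \<mu> w - s * num (\<mu> + 1) w) (at w)"
    and "num (\<mu> - 1) w - s * num (\<mu> + 1) w = - (2 * \<mu> / w * num \<mu> w)"
proof -
  note F = bessel_familyD[OF bessel_fun_family[OF L, of s] w]
  let ?F = "\<lambda>\<mu>. bessel_fun s L \<mu> w"
  have R: "s * ?F (- \<mu> + 1) = ?F (- \<mu> - 1) + 2 * \<mu> / w * ?F (- \<mu>)"
    using F(2)[of "- \<mu>"] by (simp add: algebra_simps)
  have "((\<lambda>w. \<alpha> \<mu> * bessel_fun s L \<mu> w + \<beta> \<mu> * bessel_fun s L (- \<mu>) w) has_field_derivative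
     \<alpha> \<mu> * (\<mu> / w * ?F \<mu> + s * ?F (\<mu> + 1)) + \<beta> \<mu> * (- \<mu> / w * ?F (- \<mu>) + s * ?F (- \<mu> + 1))) (at w)"
    by (intro DERIV_add DERIV_cmult F(1))
  moreover have "\<alpha> \<mu> * (\<mu> / w * ?F \<mu> + s * ?F (\<mu> + 1)) + \<beta> \<mu> * (- \<mu> / w * ?F (- \<mu>) + s * ?F (- \<mu> + 1))
     = \<mu> / w * num \<mu> w - s * num (\<mu> + 1) w"
  proof -
    have m: "- (\<mu> + 1) = - \<mu> - 1" by simp
    have N: "s * num (\<mu> + 1) w = - (s * \<alpha> \<mu> * ?F (\<mu> + 1)) - (s * s) * \<beta> \<mu> * ?F (- \<mu> - 1)"
      unfolding num_def shift m by (simp add: algebra_simps)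
    show ?thesis unfolding R N s by (simp add: num_def algebra_simps add_divide_distrib)
  qed
  ultimately show "(num \<mu> has_field_derivative \<mu> / w * num \<mu> w - s * num (\<mu> + 1) w) (at w)"
    by (simp add: num_def[abs_def])
  have m: "- (\<mu> + 1) = - \<mu> - 1" "- (\<mu> - 1) = - \<mu> + 1" by simp_all
  have "num (\<mu> - 1) w - s * num (\<mu> + 1) w = - \<alpha> \<mu> * (?F (\<mu> - 1) - s * ?F (\<mu> + 1))
     - \<beta> \<mu> * (s * ?F (- \<mu> + 1) - (s * s) * ?F (- \<mu> - 1))"
    unfolding num_def shift shift_back m by (simp add: algebra_simps)
  also have "\<dots> = - \<alpha> \<mu> * (2 * \<mu> / w * ?F \<mu>) - \<beta> \<mu> * (2 * \<mu> / w * ?F (- \<mu>))"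
    unfolding F(2) R s by simp
  also have "\<dots> = - (2 * \<mu> / w * num \<mu> w)" by (simp add: num_def algebra_simps add_divide_distrib)
  finally show "num (\<mu> - 1) w - s * num (\<mu> + 1) w = - (2 * \<mu> / w * num \<mu> w)" .
qed

text \<open>The three-term relation propagates vanishing at the orders 0 and 1 to all integers,
  upwards and downwards. Order 1 rests on F(-1) = s F(1), the same relation at order 0, where its
  right side vanishes. The reflection formula for general integer order is thus bypassed.\<close>

lemma num_int:
  assumes w: "w \<in> S" and c: "c \<in> \<int>"
  shows "num c w = 0"
proof -
  note F = bessel_familyD(2)[OF bessel_fun_family[OF L, of s] w]
  have up: "num (\<mu> + 1) w = s * (num (\<mu> - 1) w + 2 * \<mu> / w * num \<mu> w)" for \<mu>
  proof -
    have "s * num (\<mu> + 1) w = num (\<mu> - 1) w + 2 * \<mu> / w * num \<mu> w"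
      using num_family(2)[OF w, of \<mu>] by (simp add: algebra_simps)
    then have "(s * s) * num (\<mu> + 1) w = s * (num (\<mu> - 1) w + 2 * \<mu> / w * num \<mu> w)" by (simp only: mult.assoc)
    then show ?thesis by (simp add: s)
  qed
  have down: "num (\<mu> - 1) w = s * num (\<mu> + 1) w - 2 * \<mu> / w * num \<mu> w" for \<mu>
    using num_family(2)[OF w, of \<mu>] by (simp add: algebra_simps)
  have n0: "num 0 w = 0"
    using at_0 by (simp add: num_def flip: distrib_right)
  have "num 1 w = - (\<alpha> 0 * bessel_fun s L 1 w) - s * \<beta> 0 * bessel_fun s L (- 1) w"
    using shift[of 0] by (simp add: num_def)
  also have "bessel_fun s L (- 1) w = s * bessel_fun s L 1 w" using F[of 0] by simp
  also have "- (\<alpha> 0 * bessel_fun s L 1 w) - s * \<beta> 0 * (s * bessel_fun s L 1 w)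
      = - ((\<alpha> 0 + (s * s) * \<beta> 0) * bessel_fun s L 1 w)"
    by (simp add: algebra_simps)
  finally have n1: "num 1 w = 0" by (simp add: s at_0)
  have "num (of_nat n) w = 0 \<and> num (of_nat n + 1) w = 0 \<and> num (- of_nat n) w = 0 \<and> num (- of_nat n - 1) w = 0" for n
  proof (induction n)
    case 0
    then show ?case using n0 n1 down[of 0] by simp
  next
    case (Suc n)
    have e: "- of_nat (Suc n) = - of_nat n - (1::complex)" "of_nat (Suc n) = of_nat n + (1::complex)" by simp_all
    show ?case
      unfolding e(1) unfolding e(2) using Suc up[of "of_nat n + 1"] down[of "- of_nat n - 1"] by simp
  qed
  moreover obtain k where "c = of_int k" using c by (auto elim: Ints_cases)
  ultimately show ?thesis by (cases k rule: int_cases2) auto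
qed

lemma sin_pi_shift: "sin ((\<mu> + 1) * of_real pi) = - sin (\<mu> * complex_of_real pi)"
  "sin ((\<mu> - 1) * of_real pi) = - sin (\<mu> * complex_of_real pi)"
  by (simp_all add: distrib_right left_diff_distrib sin_add sin_diff)

lemma sin_pi_eq_0_iff: "sin (\<mu> * complex_of_real pi) = 0 \<longleftrightarrow> \<mu> \<in> \<int>"
proof -
  have "sin (\<mu> * complex_of_real pi) = 0 \<longleftrightarrow> (\<exists>n::int. \<mu> = of_int n)"
    unfolding Complex_Transcendental.sin_eq_0 by simp
  then show ?thesis by (auto elim: Ints_cases)
qed

text \<open>At integer \<mu> all quotients involved are 0 because their denominators are 0, so the
  relations hold for every order and can be used throughout a neighbourhood of a limit
  point.\<close>

lemma quo_family:
  assumes w: "w \<in> S"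
  shows "(quo \<mu> has_field_derivative \<mu> / w * quo \<mu> w + s * quo (\<mu> + 1) w) (at w)"
    and "quo (\<mu> - 1) w - s * quo (\<mu> + 1) w = 2 * \<mu> / w * quo \<mu> w"
proof -
  let ?d = "sin (\<mu> * complex_of_real pi)"
  have "((\<lambda>w. num \<mu> w / ?d) has_field_derivative (\<mu> / w * num \<mu> w - s * num (\<mu> + 1) w) / ?d) (at w)"
    by (rule DERIV_cdivide[OF num_family(1)[OF w]])
  then show "(quo \<mu> has_field_derivative \<mu> / w * quo \<mu> w + s * quo (\<mu> + 1) w) (at w)"
    by (simp add: quo_def[abs_def] sin_pi_shift diff_divide_distrib)
  have "quo (\<mu> - 1) w - s * quo (\<mu> + 1) w = - ((num (\<mu> - 1) w - s * num (\<mu> + 1) w) / ?d)"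
    by (simp add: quo_def sin_pi_shift diff_divide_distrib)
  then show "quo (\<mu> - 1) w - s * quo (\<mu> + 1) w = 2 * \<mu> / w * quo \<mu> w"
    unfolding num_family(2)[OF w] by (simp add: quo_def)
qed

lemma num_bounded:
  assumes K: "compact K" "K \<subseteq> S"
  obtains B where "\<And>\<mu> w. norm \<mu> \<le> R \<Longrightarrow> w \<in> K \<Longrightarrow> norm (num \<mu> w) \<le> B"
proof -
  obtain B where B: "\<And>\<mu> w. norm \<mu> \<le> R \<Longrightarrow> w \<in> K \<Longrightarrow> norm (bessel_fun s L \<mu> w) \<le> B"
    using bessel_fun_bounded[OF L K] by metis
  have "bounded (\<alpha> ` cball 0 R)" "bounded (\<beta> ` cball 0 R)"
    using hol by (auto intro!: compact_imp_bounded compact_continuous_image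
      intro: continuous_on_subset[OF holomorphic_on_imp_continuous_on])
  then obtain A A' where A: "\<And>\<mu>. norm \<mu> \<le> R \<Longrightarrow> norm (\<alpha> \<mu>) \<le> A" and A': "\<And>\<mu>. norm \<mu> \<le> R \<Longrightarrow> norm (\<beta> \<mu>) \<le> A'"
    unfolding bounded_iff by (metis imageI mem_cball_0)
  have "norm (num \<mu> w) \<le> A * B + A' * B" if "norm \<mu> \<le> R" "w \<in> K" for \<mu> w
  proof -
    have "norm (num \<mu> w) \<le> norm (\<alpha> \<mu>) * norm (bessel_fun s L \<mu> w) + norm (\<beta> \<mu>) * norm (bessel_fun s L (- \<mu>) w)"
      unfolding num_def by (metis norm_mult norm_triangle_ineq)
    also have "\<dots> \<le> A * B + A' * B"
      using A[OF that(1)] A'[OF that(1)] B[OF that] B[of "- \<mu>", OF _ that(2)] that(1)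
      by (intro add_mono mult_mono) (auto intro: order_trans[OF norm_ge_zero])
    finally show ?thesis .
  qed
  with that show thesis by blast
qed

lemma not_Ints_punctured: "c \<in> \<int> \<Longrightarrow> \<mu> \<noteq> c \<Longrightarrow> norm (\<mu> - c) < 1 \<Longrightarrow> \<mu> \<notin> \<int>" for c \<mu> :: complex
proof
  assume *: "c \<in> \<int>" "\<mu> \<noteq> c" "norm (\<mu> - c) < 1" "\<mu> \<in> \<int>"
  then have "\<mu> - c \<in> \<int>" by simp
  then obtain k where "\<mu> - c = of_int k" by (auto elim: Ints_cases)
  moreover from this have "\<bar>real_of_int k\<bar> < 1" using *(3) by simp
  then have "k = 0" by linarith
  ultimately show False using *(2) by simp
qed

text \<open>For fixed w the singularity of the quotient at c is removable, since numerator and sine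
  both vanish there and the zero of the sine is simple. \<open>holomorphic_diff_bound\<close> on the
  circle of radius 1/2, which meets no integer, gives a Lipschitz constant valid for all w in
  K.\<close>

lemma quo_approx_sol:
  assumes K: "compact K" "K \<subseteq> S" and c: "c \<in> \<int>"
  obtains B where "0 \<le> B" "\<And>\<mu> w. \<mu> \<noteq> c \<Longrightarrow> norm (\<mu> - c) < 1/2 \<Longrightarrow> w \<in> K \<Longrightarrow> norm (quo \<mu> w - sol c w) \<le> B * norm (\<mu> - c)"
proof -
  let ?sin = "\<lambda>\<mu>. sin (\<mu> * complex_of_real pi)"
  obtain B1 where B1: "\<And>\<mu> w. norm \<mu> \<le> norm c + 1 \<Longrightarrow> w \<in> K \<Longrightarrow> norm (num \<mu> w) \<le> B1"
    using num_bounded[OF K] by metis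
  have "?sin \<mu> \<noteq> 0" if "\<mu> \<in> sphere c (1/2)" for \<mu>
  proof -
    have n: "norm (\<mu> - c) = 1/2" using that by (simp add: dist_norm norm_minus_commute)
    then have "\<mu> \<noteq> c" by auto
    with n show ?thesis using not_Ints_punctured[OF c, of \<mu>] by (simp add: sin_pi_eq_0_iff)
  qed
  then have "bounded ((\<lambda>\<mu>. inverse (?sin \<mu>)) ` sphere c (1/2))"
    by (intro compact_imp_bounded compact_continuous_image continuous_intros) auto
  then obtain B2 where B2': "\<forall>x\<in>(\<lambda>\<mu>. inverse (?sin \<mu>)) ` sphere c (1/2). norm x \<le> B2"
    unfolding bounded_iff by blast
  have B2: "norm (inverse (?sin \<mu>)) \<le> B2" if "norm (\<mu> - c) = 1/2" for \<mu>
    by (rule B2'[rule_format, OF imageI]) (use that in \<open>simp add: dist_norm norm_minus_commute\<close>)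
  define B where "B = \<bar>B1\<bar> * \<bar>B2\<bar>"
  have B: "norm (quo \<mu> w) \<le> B" if "norm (\<mu> - c) = 1/2" "w \<in> K" for \<mu> w
  proof -
    have "norm \<mu> \<le> norm c + 1" using that(1) norm_triangle_ineq2[of \<mu> c] by linarith
    then have "norm (num \<mu> w) \<le> \<bar>B1\<bar>" using B1[of \<mu> w] that(2) by linarith
    moreover have "norm (inverse (?sin \<mu>)) \<le> \<bar>B2\<bar>" using B2[OF that(1)] by linarith
    ultimately show ?thesis unfolding quo_def B_def divide_inverse norm_mult by (intro mult_mono) auto
  qed
  have "norm (quo \<mu> w - sol c w) \<le> 4 * B * norm (\<mu> - c)" if \<mu>: "\<mu> \<noteq> c" "norm (\<mu> - c) < 1/2" and w: "w \<in> K" for \<mu> w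
  proof -
    have wS: "w \<in> S" using w K(2) by blast
    \<comment> \<open>Difference quotients at c, filled in by the derivative. Both functions vanish
      at c, so away from c their ratio \<open>h\<close> is the original quotient, while at c it has
      a genuine value because the derivative of the sine is not zero there.\<close>
    define D where "D = (\<lambda>f::complex\<Rightarrow>complex. \<lambda>z. if z = c then deriv f c else (f z - f c) / (z - c))"
    define h where "h = (\<lambda>\<mu>. D (\<lambda>\<mu>. num \<mu> w) \<mu> / D ?sin \<mu>)"
    have hol_num: "(\<lambda>\<mu>. num \<mu> w) holomorphic_on UNIV"
    proof -
      have "((\<lambda>\<mu>. bessel_fun s L \<mu> w) \<circ> uminus) holomorphic_on UNIV"
        by (rule holomorphic_on_compose_gen[OF _ bessel_fun_holomorphic_order]) (auto intro!: holomorphic_intros)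
      then show ?thesis unfolding num_def
        by (intro holomorphic_intros hol bessel_fun_holomorphic_order) (simp add: o_def)
    qed
    have hol_D: "D f holomorphic_on ball c 1" if "f holomorphic_on UNIV" for f
      unfolding D_def by (rule pole_lemma_open[OF holomorphic_on_subset[OF that]]) auto
    have sin_c: "?sin c = 0" using c by (simp add: sin_pi_eq_0_iff)
    have D_sin: "D ?sin z \<noteq> 0" if "z \<in> ball c 1" for z
    proof (cases "z = c")
      case True
      have "(?sin has_field_derivative cos (c * of_real pi) * of_real pi) (at c)"
        by (auto intro!: derivative_eq_intros)
      then have "deriv ?sin c = cos (c * of_real pi) * of_real pi" by (rule DERIV_imp_deriv)
      moreover have "cos (c * of_real pi) \<noteq> 0"
        using sin_cos_squared_add[of "c * of_real pi"] sin_c by auto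
      ultimately show ?thesis using True by (simp add: D_def)
    next
      case False
      then have "z \<notin> \<int>" using not_Ints_punctured[OF c, of z] that by (simp add: dist_norm norm_minus_commute)
      then have "?sin z \<noteq> 0" by (simp only: sin_pi_eq_0_iff not_False_eq_True)
      then show ?thesis using False sin_c by (simp add: D_def)
    qed
    have h: "h holomorphic_on ball c 1"
      unfolding h_def by (intro holomorphic_on_divide hol_D hol_num D_sin) (auto intro!: holomorphic_intros)
    have hq: "h z = quo z w" if "z \<noteq> c" for z
      using that by (simp add: h_def D_def quo_def sin_c num_int[OF wS c])
    \<comment> \<open>Continuity of \<open>h\<close> shows that the limit in \<open>sol\<close>
      exists; only then does \<open>Lim\<close> denote it.\<close>
    have "isCont h c"
      using continuous_on_interior[OF holomorphic_on_imp_continuous_on[OF h], of c] by simp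
    then have "(h \<longlongrightarrow> h c) (at c)" by (simp add: isCont_def)
    then have "((\<lambda>\<mu>. quo \<mu> w) \<longlongrightarrow> h c) (at c)"
      by (rule Lim_transform_eventually) (auto simp: eventually_at_filter hq)
    then have hc: "h c = sol c w" using c by (simp add: sol_def tendsto_Lim)
    have "norm (h \<mu> - h c) \<le> 2 * B / (1/2) * norm (\<mu> - c)"
    proof (rule holomorphic_diff_bound[OF h])
      fix z assume z: "norm (z - c) = 1/2"
      then have "z \<noteq> c" by auto
      then show "norm (h z) \<le> B" using B[OF z w] by (simp add: hq)
    qed (use \<mu> in auto)
    then show ?thesis by (simp add: hq[OF \<mu>(1)] hc)
  qed
  moreover have "0 \<le> 4 * B" by (simp add: B_def)
  ultimately show thesis using that by blast
qed

lemma quo_uniform_limit: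
  assumes K: "compact K" "K \<subseteq> S" and c: "c \<in> \<int>"
  shows "uniform_limit K quo (sol c) (at c)"
proof (rule uniform_limitI)
  fix e :: real assume e: "0 < e"
  obtain B where B: "0 \<le> B" "\<And>\<mu> w. \<mu> \<noteq> c \<Longrightarrow> norm (\<mu> - c) < 1/2 \<Longrightarrow> w \<in> K \<Longrightarrow> norm (quo \<mu> w - sol c w) \<le> B * norm (\<mu> - c)"
    using quo_approx_sol[OF assms] by metis
  \<comment> \<open>Dividing by B + 1 covers the case B = 0.\<close>
  define d where "d = min (1/2) (e / (B + 1))"
  have d: "0 < d" "d \<le> 1/2" "d \<le> e / (B + 1)" using e B(1) by (simp_all only: d_def min.cobounded1 min.cobounded2) (simp add: min_def)
  from d(3) have de: "d * (B + 1) \<le> e" using B(1) by (simp add: pos_le_divide_eq)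
  have "dist (quo \<mu> w) (sol c w) < e" if "\<mu> \<noteq> c" "dist \<mu> c < d" "w \<in> K" for \<mu> w
  proof -
    have "norm (quo \<mu> w - sol c w) \<le> B * norm (\<mu> - c)" using that d by (intro B) (auto simp: dist_norm)
    also have "\<dots> \<le> B * d" using that B(1) by (intro mult_left_mono) (auto simp: dist_norm)
    also have "\<dots> < d * (B + 1)" using d(1) by (simp add: algebra_simps)
    finally show ?thesis using de by (simp add: dist_norm)
  qed
  then show "\<forall>\<^sub>F \<mu> in at c. \<forall>w\<in>K. dist (quo \<mu> w) (sol c w) < e"
    unfolding eventually_at using d(1) by blast
qed

lemma quo_tendsto_sol:
  assumes "w \<in> S" "c \<in> \<int>"
  shows "((\<lambda>\<mu>. quo \<mu> w) \<longlongrightarrow> sol c w) (at c)"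
  using tendsto_uniform_limitI[OF quo_uniform_limit[of "{w}" c], of w] assms by simp

text \<open>Away from the integers all three orders are given by plain quotients. At an integer all
  three are limits: the three-term relation passes to the limit pointwise, and the derivative by
  locally uniform convergence of holomorphic functions.\<close>

lemma sol_family: "bessel_family s S sol"
  unfolding bessel_family_def
proof (intro allI ballI)
  fix c w assume w: "w \<in> S"
  show "(sol c has_field_derivative c / w * sol c w + s * sol (c + 1) w) (at w) \<and>
     sol (c - 1) w - s * sol (c + 1) w = 2 * c / w * sol c w"
  proof (cases "c \<in> \<int>")
    case False
    then have "c + 1 \<notin> \<int>" "c - 1 \<notin> \<int>"
      by (metis Ints_1 Ints_diff add_diff_cancel_right') (metis False Ints_1 Ints_add diff_add_cancel)
    with False have e: "sol c = quo c" "sol (c + 1) = quo (c + 1)" "sol (c - 1) = quo (c - 1)"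
      by (auto simp: sol_def)
    show ?thesis unfolding e using quo_family[OF w] by blast
  next
    case True
    have t: "((\<lambda>\<mu>. quo \<mu> w) \<longlongrightarrow> sol c w) (at c)" by (rule quo_tendsto_sol[OF w True])
    have shifted: "((\<lambda>\<mu>. quo (\<mu> + k) w) \<longlongrightarrow> sol (c + k) w) (at c)" if "k \<in> \<int>" for k
      using quo_tendsto_sol[OF w, of "c + k"] True that LIM_offset[of "\<lambda>\<mu>. quo \<mu> w" _ "c + k" k] by simp
    have tp: "((\<lambda>\<mu>. quo (\<mu> + 1) w) \<longlongrightarrow> sol (c + 1) w) (at c)" using shifted[of 1] by simp
    have tm: "((\<lambda>\<mu>. quo (\<mu> - 1) w) \<longlongrightarrow> sol (c - 1) w) (at c)" using shifted[of "-1"] by simp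
    obtain r where r: "0 < r" "cball w r \<subseteq> S" using open_branch[OF L] w open_contains_cball by blast
    have deriv: "(quo \<mu> has_field_derivative \<mu> / v * quo \<mu> v + s * quo (\<mu> + 1) v) (at v)" if "v \<in> cball w r" for \<mu> v
      using that r(2) by (intro quo_family) blast
    have "\<forall>\<^sub>F \<mu> in at c. continuous_on (cball w r) (quo \<mu>) \<and>
       (\<forall>v\<in>ball w r. (quo \<mu> has_field_derivative \<mu> / v * quo \<mu> v + s * quo (\<mu> + 1) v) (at v))"
      by (intro always_eventually allI conjI ballI DERIV_continuous_on[OF has_field_derivative_at_within[OF deriv]] deriv) auto
    then obtain g' where "continuous_on (cball w r) (sol c)" and g': "\<And>v. v \<in> ball w r \<Longrightarrow> (sol c has_field_derivative g' v) (at v) \<and>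
        ((\<lambda>\<mu>. \<mu> / v * quo \<mu> v + s * quo (\<mu> + 1) v) \<longlongrightarrow> g' v) (at c)"
      by (rule has_complex_derivative_uniform_limit[OF _ quo_uniform_limit[OF compact_cball r(2) True] _ r(1)]) (simp, blast)
    have "((\<lambda>\<mu>. \<mu> / w * quo \<mu> w + s * quo (\<mu> + 1) w) \<longlongrightarrow> c / w * sol c w + s * sol (c + 1) w) (at c)"
      using branch_nonzero[OF L w] by (intro tendsto_intros t tp) auto
    \<comment> \<open>The convergence theorem supplies only some \<open>g'\<close> to which the
      derivatives tend; uniqueness of limits identifies it.\<close>
    then have "g' w = c / w * sol c w + s * sol (c + 1) w"
      using g'[of w] r(1) by (intro tendsto_unique[of "at c"]) auto
    moreover have "((\<lambda>\<mu>. quo (\<mu> - 1) w - s * quo (\<mu> + 1) w) \<longlongrightarrow> sol (c - 1) w - s * sol (c + 1) w) (at c)"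
      by (intro tendsto_intros tp tm)
    moreover have "((\<lambda>\<mu>. 2 * \<mu> / w * quo \<mu> w) \<longlongrightarrow> 2 * c / w * sol c w) (at c)"
      using branch_nonzero[OF L w] by (intro tendsto_intros t) auto
    ultimately show ?thesis
      using g'[of w] r(1) tendsto_unique[of "at c"] unfolding quo_family(2)[OF w] by auto
  qed
qed

end

subsection \<open>The four derivative formulas\<close>

text \<open>Dividing by the power removes \<nu>/w from (\<nu>+m)/w and leaves m/w.\<close>

lemma bessel_family_shift_family_div:
  assumes L: "log_branch L S" and s: "s * s = 1" and G: "bessel_family s S G"
  shows "shift_family S s \<nu> (\<lambda>m w. s ^ m * (G (\<nu> + of_nat m) w / branch_pow L \<nu> w))"
proof
  show "open S" by (rule open_branch[OF L])
  show "s * s = 1" by (rule s)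
  fix m w assume w: "w \<in> S"
  let ?p = "branch_pow L \<nu> w"
  have p: "?p \<noteq> 0" by (simp add: branch_pow_def)
  have w0: "w \<noteq> 0" by (rule branch_nonzero[OF L w])
  note G' = bessel_familyD[OF G w]
  have "((\<lambda>w. G (\<nu> + of_nat m) w / branch_pow L \<nu> w) has_field_derivative
    (((\<nu> + of_nat m) / w * G (\<nu> + of_nat m) w + s * G (\<nu> + of_nat m + 1) w) * ?p
     - G (\<nu> + of_nat m) w * (\<nu> / w * ?p)) / (?p * ?p)) (at w)"
    by (rule DERIV_divide[OF G'(1) deriv_branch_pow[OF L w] p])
  also have "(((\<nu> + of_nat m) / w * G (\<nu> + of_nat m) w + s * G (\<nu> + of_nat m + 1) w) * ?p
     - G (\<nu> + of_nat m) w * (\<nu> / w * ?p)) / (?p * ?p) =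
     of_nat m / w * (G (\<nu> + of_nat m) w / ?p) + s * (G (\<nu> + of_nat (Suc m)) w / ?p)"
    using p w0 by (simp add: field_simps)
  finally have "((\<lambda>w. s ^ m * (G (\<nu> + of_nat m) w / branch_pow L \<nu> w)) has_field_derivative
     s ^ m * (of_nat m / w * (G (\<nu> + of_nat m) w / ?p) + s * (G (\<nu> + of_nat (Suc m)) w / ?p))) (at w)"
    by (rule DERIV_cmult)
  then show "((\<lambda>w. s ^ m * (G (\<nu> + of_nat m) w / branch_pow L \<nu> w)) has_field_derivative
     of_nat m / w * (s ^ m * (G (\<nu> + of_nat m) w / ?p)) + s ^ Suc m * (G (\<nu> + of_nat (Suc m)) w / ?p)) (at w)"
    by (simp only: distrib_left power_Suc mult_ac)
  have e: "\<nu> + of_nat (Suc m) - 1 = \<nu> + of_nat m" "\<nu> + of_nat (Suc m) + 1 = \<nu> + of_nat (Suc (Suc m))" by simp_all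
  have "2 * (\<nu> + of_nat (Suc m)) / w * (s ^ Suc m * (G (\<nu> + of_nat (Suc m)) w / ?p))
    = s ^ Suc m * ((2 * (\<nu> + of_nat (Suc m)) / w * G (\<nu> + of_nat (Suc m)) w) / ?p)"
    by (simp only: mult_ac times_divide_eq_right)
  also have "\<dots> = s ^ Suc m * ((G (\<nu> + of_nat m) w - s * G (\<nu> + of_nat (Suc (Suc m))) w) / ?p)"
    unfolding G'(2)[of "\<nu> + of_nat (Suc m)", unfolded e, symmetric] ..
  also have "\<dots> = s * (s ^ m * (G (\<nu> + of_nat m) w / ?p)) - s ^ Suc (Suc m) * (G (\<nu> + of_nat (Suc (Suc m))) w / ?p)"
    by (simp add: diff_divide_distrib right_diff_distrib mult_ac)
  finally show "2 * (\<nu> + of_nat (Suc m)) / w * (s ^ Suc m * (G (\<nu> + of_nat (Suc m)) w / ?p)) =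
    s * (s ^ m * (G (\<nu> + of_nat m) w / ?p)) - s ^ Suc (Suc m) * (G (\<nu> + of_nat (Suc (Suc m))) w / ?p)" .
qed

text \<open>Orders now descend, so the three-term relation replaces order \<nu>-m+1 by \<nu>-m-1,
  and the terms in 1/w add up to \<nu> + (\<nu>-m) - 2(\<nu>-m) = m. The parameter of the family
  becomes -\<nu>, whence the coefficients at -\<nu> and the exclusion of positive integers.\<close>

lemma bessel_family_shift_family_mult:
  assumes L: "log_branch L S" and s: "s * s = 1" and G: "bessel_family s S G"
  shows "shift_family S s (- \<nu>) (\<lambda>m w. branch_pow L \<nu> w * G (\<nu> - of_nat m) w)"
proof
  show "open S" by (rule open_branch[OF L])
  show "s * s = 1" by (rule s)
  fix m w assume w: "w \<in> S"
  let ?p = "branch_pow L \<nu> w"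
  note G' = bessel_familyD[OF G w]
  have e: "\<nu> - of_nat m - 1 = \<nu> - of_nat (Suc m)" by simp
  have "((\<lambda>w. branch_pow L \<nu> w * G (\<nu> - of_nat m) w) has_field_derivative
     \<nu> / w * ?p * G (\<nu> - of_nat m) w
     + ((\<nu> - of_nat m) / w * G (\<nu> - of_nat m) w + s * G (\<nu> - of_nat m + 1) w) * ?p) (at w)"
    by (rule DERIV_mult[OF deriv_branch_pow[OF L w] G'(1)])
  also have "s * G (\<nu> - of_nat m + 1) w = G (\<nu> - of_nat (Suc m)) w - 2 * (\<nu> - of_nat m) / w * G (\<nu> - of_nat m) w"
    using G'(2)[of "\<nu> - of_nat m", unfolded e] by (simp add: algebra_simps)
  also have "\<nu> / w * ?p * G (\<nu> - of_nat m) w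
     + ((\<nu> - of_nat m) / w * G (\<nu> - of_nat m) w +
       (G (\<nu> - of_nat (Suc m)) w - 2 * (\<nu> - of_nat m) / w * G (\<nu> - of_nat m) w)) * ?p =
     of_nat m / w * (?p * G (\<nu> - of_nat m) w) + ?p * G (\<nu> - of_nat (Suc m)) w"
    using branch_nonzero[OF L w] by (simp add: field_simps)
  finally show "((\<lambda>w. branch_pow L \<nu> w * G (\<nu> - of_nat m) w) has_field_derivative
     of_nat m / w * (?p * G (\<nu> - of_nat m) w) + ?p * G (\<nu> - of_nat (Suc m)) w) (at w)" .
  have e: "\<nu> - of_nat (Suc m) - 1 = \<nu> - of_nat (Suc (Suc m))" "\<nu> - of_nat (Suc m) + 1 = \<nu> - of_nat m" by simp_all
  have "2 * (- D) / w * (q * x) = - (q * (2 * D / w * x))" for D q x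
    by simp
  moreover have "- \<nu> + of_nat (Suc m) = - (\<nu> - of_nat (Suc m))" by simp
  ultimately have "2 * (- \<nu> + of_nat (Suc m)) / w * (?p * G (\<nu> - of_nat (Suc m)) w)
    = - (?p * (2 * (\<nu> - of_nat (Suc m)) / w * G (\<nu> - of_nat (Suc m)) w))"
    by (simp only:)
  also have "\<dots> = s * (?p * G (\<nu> - of_nat m) w) - ?p * G (\<nu> - of_nat (Suc (Suc m))) w"
    unfolding G'(2)[of "\<nu> - of_nat (Suc m)", unfolded e, symmetric] by (simp only: right_diff_distrib mult_ac minus_diff_eq)
  finally show "2 * (- \<nu> + of_nat (Suc m)) / w * (?p * G (\<nu> - of_nat (Suc m)) w) =
    s * (?p * G (\<nu> - of_nat m) w) - ?p * G (\<nu> - of_nat (Suc (Suc m))) w" .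
qed

lemma (in shift_family) has_nth_complex_derivative:
  assumes z: "z \<in> S"
  shows "\<nu> \<notin> neg_int_seg (2*n - 1) \<Longrightarrow>
      has_nth_complex_derivative (g 0) (2*n) (\<Sum>k=0..n. \<epsilon>^(n+k) * coeff_A n k \<nu> * g (2*k) z) z"
    and "\<nu> \<notin> neg_int_seg (2*n) \<Longrightarrow>
      has_nth_complex_derivative (g 0) (2*n+1) (\<Sum>k=0..n. \<epsilon>^(n+k) * coeff_B n k \<nu> * g (2*k+1) z) z"
proof -
  have "g 0 holomorphic_on S"
    using deriv_g[of _ 0] open_S by (auto simp: holomorphic_on_open)
  then have "g 0 analytic_on {z}" using open_S z analytic_at by blast
  then show "\<nu> \<notin> neg_int_seg (2*n - 1) \<Longrightarrow>
      has_nth_complex_derivative (g 0) (2*n) (\<Sum>k=0..n. \<epsilon>^(n+k) * coeff_A n k \<nu> * g (2*k) z) z"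
    and "\<nu> \<notin> neg_int_seg (2*n) \<Longrightarrow>
      has_nth_complex_derivative (g 0) (2*n+1) (\<Sum>k=0..n. \<epsilon>^(n+k) * coeff_B n k \<nu> * g (2*k+1) z) z"
    using higher_deriv[OF _ z] by (simp_all only: has_nth_complex_derivative_def atLeast0AtMost simp_thms)
qed

lemma bessel_family_derivs:
  assumes L: "log_branch L S" and s: "s * s = 1" and G: "bessel_family s S G" and z: "z \<in> S"
  shows "\<nu> \<notin> neg_int_seg (2*n - 1) \<Longrightarrow>
      has_nth_complex_derivative (\<lambda>w. G \<nu> w / branch_pow L \<nu> w) (2*n)
        (\<Sum>k=0..n. s ^ (n + k) * coeff_A n k \<nu> * (G (\<nu> + 2 * of_nat k) z / branch_pow L \<nu> z)) z"
    and "\<nu> \<notin> neg_int_seg (2*n) \<Longrightarrow>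
      has_nth_complex_derivative (\<lambda>w. G \<nu> w / branch_pow L \<nu> w) (2*n + 1)
        (\<Sum>k=0..n. s ^ (n + k + 1) * coeff_B n k \<nu> * (G (\<nu> + 2 * of_nat k + 1) z / branch_pow L \<nu> z)) z"
    and "\<nu> \<notin> int_seg (2*n - 1) \<Longrightarrow>
      has_nth_complex_derivative (\<lambda>w. branch_pow L \<nu> w * G \<nu> w) (2*n)
        (\<Sum>k=0..n. s ^ (n + k) * coeff_A n k (-\<nu>) * (branch_pow L \<nu> z * G (\<nu> - 2 * of_nat k) z)) z"
    and "\<nu> \<notin> int_seg (2*n) \<Longrightarrow>
      has_nth_complex_derivative (\<lambda>w. branch_pow L \<nu> w * G \<nu> w) (2*n + 1)
        (\<Sum>k=0..n. s ^ (n + k) * coeff_B n k (-\<nu>) * (branch_pow L \<nu> z * G (\<nu> - 2 * of_nat k - 1) z)) z"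
proof -
  interpret d: shift_family S s \<nu> "\<lambda>m w. s ^ m * (G (\<nu> + of_nat m) w / branch_pow L \<nu> w)"
    by (rule bessel_family_shift_family_div[OF L s G])
  interpret m: shift_family S s "- \<nu>" "\<lambda>m w. branch_pow L \<nu> w * G (\<nu> - of_nat m) w"
    by (rule bessel_family_shift_family_mult[OF L s G])
  \<comment> \<open>Only odd indices of the quotient family keep a factor s. This is the extra sign
    in its odd formula; the product family carries no powers of s.\<close>
  have even: "s ^ (2 * k) = 1" for k by (simp add: power_mult power2_eq_square s)
  have odd: "s ^ (n + k) * c * (s ^ (2 * k + 1) * x) = s ^ (n + k + 1) * c * x" for k c x
    by (simp only: power_add even power_one_right) (simp add: mult_ac)
  have e: "\<nu> + of_nat (2 * k) = \<nu> + 2 * of_nat k" "\<nu> + of_nat (2 * k + 1) = \<nu> + 2 * of_nat k + 1"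
     "\<nu> - of_nat (2 * k) = \<nu> - 2 * of_nat k" "\<nu> - of_nat (2 * k + 1) = \<nu> - 2 * of_nat k - 1" for k
    by simp_all
  show "\<nu> \<notin> neg_int_seg (2*n - 1) \<Longrightarrow>
      has_nth_complex_derivative (\<lambda>w. G \<nu> w / branch_pow L \<nu> w) (2*n)
        (\<Sum>k=0..n. s ^ (n + k) * coeff_A n k \<nu> * (G (\<nu> + 2 * of_nat k) z / branch_pow L \<nu> z)) z"
    using d.has_nth_complex_derivative(1)[OF z, of n, unfolded e even] by simp
  show "\<nu> \<notin> neg_int_seg (2*n) \<Longrightarrow>
      has_nth_complex_derivative (\<lambda>w. G \<nu> w / branch_pow L \<nu> w) (2*n + 1)
        (\<Sum>k=0..n. s ^ (n + k + 1) * coeff_B n k \<nu> * (G (\<nu> + 2 * of_nat k + 1) z / branch_pow L \<nu> z)) z"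
    using d.has_nth_complex_derivative(2)[OF z, of n, unfolded e odd] by simp
  show "\<nu> \<notin> int_seg (2*n - 1) \<Longrightarrow>
      has_nth_complex_derivative (\<lambda>w. branch_pow L \<nu> w * G \<nu> w) (2*n)
        (\<Sum>k=0..n. s ^ (n + k) * coeff_A n k (-\<nu>) * (branch_pow L \<nu> z * G (\<nu> - 2 * of_nat k) z)) z"
    using m.has_nth_complex_derivative(1)[OF z, of n, unfolded e] by (simp add: not_int_seg_iff)
  show "\<nu> \<notin> int_seg (2*n) \<Longrightarrow>
      has_nth_complex_derivative (\<lambda>w. branch_pow L \<nu> w * G \<nu> w) (2*n + 1)
        (\<Sum>k=0..n. s ^ (n + k) * coeff_B n k (-\<nu>) * (branch_pow L \<nu> z * G (\<nu> - 2 * of_nat k - 1) z)) z"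
    using m.has_nth_complex_derivative(2)[OF z, of n, unfolded e] by (simp add: not_int_seg_iff)
qed

section \<open>The concrete functions of the theorem\<close>

lemma bessel_Y_family:
  assumes L: "log_branch L S"
  shows "bessel_family (-1) S (bessel_Y L)"
proof -
  \<comment> \<open>For s = -1 the condition on \<beta> is periodicity, met by a constant, and cos 0
    - 1 = 0 is the condition at order 0.\<close>
  interpret second_solution L S "-1" "\<lambda>\<mu>. cos (\<mu> * of_real pi)" "\<lambda>_. -1"
    by unfold_locales (auto simp: L distrib_right cos_add intro!: holomorphic_intros)
  have "bessel_Y L = sol"
    by (simp add: fun_eq_iff bessel_Y_def sol_def quo_def num_def bessel_J_eq Let_def mult.commute)
  then show ?thesis using sol_family by simp
qed

text \<open>K alone satisfies both relations with the opposite sign at the shifted orders; the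
  exponential changes sign under a unit shift and corrects this.\<close>

lemma bessel_K_family:
  assumes L: "log_branch L S"
  shows "bessel_family 1 S (\<lambda>\<nu> w. exp (\<nu> * of_real pi * \<i>) * bessel_K L \<nu> w)"
proof -
  let ?e = "\<lambda>\<mu>. exp (\<mu> * of_real pi * \<i>)"
  have e1: "?e (\<mu> + 1) = - ?e \<mu>" for \<mu>
    by (simp add: distrib_right exp_add mult.assoc)
  interpret second_solution L S 1 "\<lambda>\<mu>. - (of_real pi / 2 * ?e \<mu>)" "\<lambda>\<mu>. of_real pi / 2 * ?e \<mu>"
    by unfold_locales (auto simp: L e1 intro!: holomorphic_intros)
  define q where "q = (\<lambda>w \<mu>. of_real pi / 2 * (bessel_I L (-\<mu>) w - bessel_I L \<mu> w) / sin (\<mu> * of_real pi))"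
  have quo: "quo \<mu> w = ?e \<mu> * q w \<mu>" for \<mu> w
    unfolding quo_def num_def q_def bessel_I_eq by (simp add: algebra_simps diff_divide_distrib)
  have "?e \<nu> * bessel_K L \<nu> w = sol \<nu> w" if w: "w \<in> S" for \<nu> w
  proof (cases "\<nu> \<in> \<int>")
    case True
    \<comment> \<open>In \<open>sol\<close> the exponential stands under the limit, in K outside it;
      being continuous and nowhere zero, it can be divided out.\<close>
    have "((\<lambda>\<mu>. quo \<mu> w / ?e \<mu>) \<longlongrightarrow> sol \<nu> w / ?e \<nu>) (at \<nu>)"
      by (intro tendsto_intros quo_tendsto_sol[OF w True]) auto
    moreover have "(\<lambda>\<mu>. quo \<mu> w / ?e \<mu>) = q w" unfolding quo by simp
    ultimately have "Lim (at \<nu>) (q w) = sol \<nu> w / ?e \<nu>" by (intro tendsto_Lim) simp_all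
    then show ?thesis using True by (simp add: bessel_K_def Let_def q_def)
  next
    case False
    then have "sol \<nu> w = ?e \<nu> * q w \<nu>" by (simp only: sol_def quo if_False)
    with False show ?thesis by (simp only: bessel_K_def Let_def q_def if_False)
  qed
  note K = this
  show ?thesis
    unfolding bessel_family_def
  proof (intro allI ballI conjI)
    fix \<mu> w assume w: "w \<in> S"
    note F = bessel_familyD[OF sol_family w, of \<mu>]
    show "((\<lambda>w. ?e \<mu> * bessel_K L \<mu> w) has_field_derivative
      \<mu> / w * (?e \<mu> * bessel_K L \<mu> w) + 1 * (?e (\<mu> + 1) * bessel_K L (\<mu> + 1) w)) (at w)"
      unfolding K[OF w]
      \<comment> \<open>The identification with \<open>sol\<close> is known on S only, so the
        derivative is transferred through the openness of S.\<close>
      by (rule has_field_derivative_transform_within_open[OF F(1) open_branch[OF L] w]) (simp add: K)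
    show "?e (\<mu> - 1) * bessel_K L (\<mu> - 1) w - 1 * (?e (\<mu> + 1) * bessel_K L (\<mu> + 1) w) = 2 * \<mu> / w * (?e \<mu> * bessel_K L \<mu> w)"
      unfolding K[OF w] by (rule F(2))
  qed
qed

lemma cylinder_comb_family:
  assumes L: "log_branch L S"
  shows "bessel_family (-1) S (cylinder_comb a b c d L)"
proof -
  have "cylinder_comb a b c d L = (\<lambda>\<mu> w. (a + c + d) * bessel_J L \<mu> w + (b + c * \<i> - d * \<i>) * bessel_Y L \<mu> w)"
    by (simp add: fun_eq_iff cylinder_comb_def hankel_H1_def hankel_H2_def algebra_simps)
  moreover have "bessel_family (-1) S (bessel_J L)"
    unfolding bessel_J_eq by (rule bessel_fun_family[OF L])
  ultimately show ?thesis using bessel_family_lincomb bessel_Y_family[OF L] by simp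
qed

lemma modified_comb_family:
  assumes L: "log_branch L S"
  shows "bessel_family 1 S (modified_comb p q L)"
proof -
  have "bessel_family 1 S (bessel_I L)"
    unfolding bessel_I_eq by (rule bessel_fun_family[OF L])
  from bessel_family_lincomb[OF this bessel_K_family[OF L], of p q] show ?thesis
    by (simp add: modified_comb_def[abs_def])
qed

theorem corollary3p2:
  fixes L :: "complex \<Rightarrow> complex" and S :: "complex set"
    and a b c d p q \<nu> z :: complex and n :: nat
  assumes "log_branch L S" and "z \<in> S"
  shows
    "(\<nu> \<notin> neg_int_seg (2*n - 1) \<longrightarrow>
        has_nth_complex_derivative (\<lambda>w. cylinder_comb a b c d L \<nu> w / branch_pow L \<nu> w) (2*n)
          (\<Sum>k=0..n. (-1) ^ (n + k) * coeff_A n k \<nu> *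
             (cylinder_comb a b c d L (\<nu> + 2 * of_nat k) z / branch_pow L \<nu> z)) z) \<and>
     (\<nu> \<notin> neg_int_seg (2*n) \<longrightarrow>
        has_nth_complex_derivative (\<lambda>w. cylinder_comb a b c d L \<nu> w / branch_pow L \<nu> w) (2*n + 1)
          (\<Sum>k=0..n. (-1) ^ (n + k + 1) * coeff_B n k \<nu> *
             (cylinder_comb a b c d L (\<nu> + 2 * of_nat k + 1) z / branch_pow L \<nu> z)) z) \<and>
     (\<nu> \<notin> int_seg (2*n - 1) \<longrightarrow>
        has_nth_complex_derivative (\<lambda>w. branch_pow L \<nu> w * cylinder_comb a b c d L \<nu> w) (2*n)
          (\<Sum>k=0..n. (-1) ^ (n + k) * coeff_A n k (-\<nu>) *
             (branch_pow L \<nu> z * cylinder_comb a b c d L (\<nu> - 2 * of_nat k) z)) z) \<and>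
     (\<nu> \<notin> int_seg (2*n) \<longrightarrow>
        has_nth_complex_derivative (\<lambda>w. branch_pow L \<nu> w * cylinder_comb a b c d L \<nu> w) (2*n + 1)
          (\<Sum>k=0..n. (-1) ^ (n + k) * coeff_B n k (-\<nu>) *
             (branch_pow L \<nu> z * cylinder_comb a b c d L (\<nu> - 2 * of_nat k - 1) z)) z) \<and>
     (\<nu> \<notin> neg_int_seg (2*n - 1) \<longrightarrow>
        has_nth_complex_derivative (\<lambda>w. modified_comb p q L \<nu> w / branch_pow L \<nu> w) (2*n)
          (\<Sum>k=0..n. coeff_A n k \<nu> *
             (modified_comb p q L (\<nu> + 2 * of_nat k) z / branch_pow L \<nu> z)) z) \<and>
     (\<nu> \<notin> neg_int_seg (2*n) \<longrightarrow>
        has_nth_complex_derivative (\<lambda>w. modified_comb p q L \<nu> w / branch_pow L \<nu> w) (2*n + 1)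
          (\<Sum>k=0..n. coeff_B n k \<nu> *
             (modified_comb p q L (\<nu> + 2 * of_nat k + 1) z / branch_pow L \<nu> z)) z) \<and>
     (\<nu> \<notin> int_seg (2*n - 1) \<longrightarrow>
        has_nth_complex_derivative (\<lambda>w. branch_pow L \<nu> w * modified_comb p q L \<nu> w) (2*n)
          (\<Sum>k=0..n. coeff_A n k (-\<nu>) *
             (branch_pow L \<nu> z * modified_comb p q L (\<nu> - 2 * of_nat k) z)) z) \<and>
     (\<nu> \<notin> int_seg (2*n) \<longrightarrow>
        has_nth_complex_derivative (\<lambda>w. branch_pow L \<nu> w * modified_comb p q L \<nu> w) (2*n + 1)
          (\<Sum>k=0..n. coeff_B n k (-\<nu>) *
             (branch_pow L \<nu> z * modified_comb p q L (\<nu> - 2 * of_nat k - 1) z)) z)"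
proof -
  note C = bessel_family_derivs[OF assms(1) _ cylinder_comb_family[OF assms(1), of a b c d] assms(2), of \<nu> n, simplified]
  note M = bessel_family_derivs[OF assms(1) _ modified_comb_family[OF assms(1), of p q] assms(2), of \<nu> n, simplified]
  show ?thesis using C M by simp
qed

end
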